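(* Assume $P\in[0,1)$ and $\lim_{x\uparrow 1/P}F(x)=\infty$. Let $\varepsilon>0$ be fixed. Then, as $s\to\infty$, $$\gamma_{s,F}(\varepsilon)=\gamma_{\infty,F}(\varepsilon)+\frac{1}{\sqrt{s}}\,\eta_{\infty,F}(\varepsilon)+O(s^{-1}),\qquad \eta_{\infty,F}(\varepsilon)=-\frac{h_{\infty,F}(\gamma_{\infty,F}(\varepsilon))}{(1+F(1))\,g_\infty'(\gamma_{\infty,F}(\varepsilon))},$$ and, assuming in addition that for every $s$ the function $\gamma\mapsto D_F^R(s,s-\gamma\sqrt{s})$ is monotonic on $(\gamma_P,\sqrt{s}]$, $$\gamma_{s,F}^R(\varepsilon)=\gamma_{\infty}^R(\varepsilon)+\frac{1}{\sqrt{s}}\,\eta_{\infty,F}^R(\varepsilon)+O(s^{-1}),\qquad \eta_{\infty,F}^R(\varepsilon)=-\frac{h_{\infty,F}^R(\gamma_{\infty}^R(\varepsilon))}{g_\infty'(\gamma_{\infty}^R(\varepsilon))}.$$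
   Context: $\Phi$ and $\varphi$ are the standard normal distribution function and density. $s\ge1$ is an integer (number of servers) and $(p_k)_{k\ge s}$ is a sequence in $[0,1]$ (admission policy). The numbers $p_{s+n}$, $n\ge 0$, do not depend on $s$ (i.e. $p_{s+n}=q_n$ for a fixed sequence $(q_n)_{n\ge0}$ in $[0,1]$), so that the power series $F(x)=\sum_{n=0}^{\infty}p_s\cdots p_{s+n}\,x^{n+1}$ and the number $P=\limsup_{n\to\infty}(p_s\cdots p_{s+n})^{1/(n+1)}\in[0,1]$ do not depend on $s$. The radius of convergence of $F$ is $1/P$ ($=\infty$ if $P=0$). Put $\lambda_P=s/P$ ($=\infty$ if $P=0$) and $\gamma_P=-\frac{1-P}{P}\sqrt{s}$ ($=-\infty$ if $P=0$). The Erlang B function is $B(s,\lambda)=\dfrac{\lambda^s/s!}{\sum_{k=0}^s\lambda^k/k!}$. For $0<\lambda<\lambda_P$ define $$D_F(s,\lambda)=\frac{1+F(\lambda/s)}{B(s,\lambda)^{-1}+F(\lambda/s)},\qquad D_F^R(s,\lambda)=\frac{1+(1-s/\lambda)F(\lambda/s)}{B(s,\lambda)^{-1}+F(\lambda/s)},$$ with $D_F(s,0)=D_F^R(s,0)=0$. $\gamma_{s,F}(\varepsilon)$ denotes the unique solution $\gamma\in(\gamma_P,\sqrt{s})$ of $\sqrt{s}\,D_F(s,s-\gamma\sqrt{s})=\varepsilon$ (which exists for $0<\varepsilon<\sqrt{s}$), and $\gamma_{s,F}^R(\varepsilon)$ the unique solution $\gamma\in(\gamma_P,\sqrt{s})$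 of $\sqrt{s}\,D_F^R(s,s-\gamma\sqrt{s})=\varepsilon$ (which exists for $0<\varepsilon<(1-P)\sqrt{s}$ under the monotonicity assumption). For $\gamma\in\mathbb{R}$, $g_\infty(\gamma)=\varphi(\gamma)/\Phi(\gamma)$, which decreases strictly from $+\infty$ to $0$ on $\mathbb{R}$; $\gamma_{\infty,F}(\varepsilon)$ and $\gamma_\infty^R(\varepsilon)$ are the unique real solutions of $(1+F(1))g_\infty(\gamma)=\varepsilon$ and $g_\infty(\gamma)=\varepsilon$, respectively. Further, $$h_\infty(\gamma)=-\tfrac13\big(\gamma^3+(\gamma^2+2)g_\infty(\gamma)\big)g_\infty(\gamma),$$ $$h_{\infty,F}(\gamma)=(1+F(1))h_\infty(\gamma)-\big(\gamma F'(1)+(1+F(1))F(1)g_\infty(\gamma)\big)g_\infty(\gamma),$$ $$h_{\infty,F}^R(\gamma)=h_\infty(\gamma)-(\gamma+g_\infty(\gamma))g_\infty(\gamma)F(1).$$ *)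

theory Defs
  imports "HOL-Probability.Probability" "HOL-Library.Landau_Symbols"
begin

text \<open>
  The admission policy enters only through the sequence \<open>q n = p\<^sub>s\<^sub>+\<^sub>n\<close>, which does not depend
  on the number \<open>s\<close> of servers.
\<close>

definition F :: "(nat \<Rightarrow> real) \<Rightarrow> real \<Rightarrow> real" where
  "F q x = (\<Sum>n. (\<Prod>i\<le>n. q i) * x ^ (n + 1))"

text \<open>The limit superior is taken in the extended reals; it lies in [0,1] for \<open>q\<close> in [0,1].\<close>

definition P_lim :: "(nat \<Rightarrow> real) \<Rightarrow> real" where
  "P_lim q = real_of_ereal (limsup (\<lambda>n. ereal (root (n + 1) (\<Prod>i\<le>n. q i))))"

text \<open>The filter of \<open>x\<close> increasing to the radius of convergence \<open>1/P\<close> (which is \<open>\<infinity>\<close> if \<open>P = 0\<close>).\<close>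

definition at_radius :: "(nat \<Rightarrow> real) \<Rightarrow> real filter" where
  "at_radius q = (if P_lim q = 0 then at_top else at_left (1 / P_lim q))"

definition gamma_P :: "(nat \<Rightarrow> real) \<Rightarrow> nat \<Rightarrow> ereal" where
  "gamma_P q s = (if P_lim q = 0 then -\<infinity> else ereal (- ((1 - P_lim q) / P_lim q) * sqrt (real s)))"

definition erlang_B :: "nat \<Rightarrow> real \<Rightarrow> real" where
  "erlang_B s lam = (lam ^ s / fact s) / (\<Sum>k=0..s. lam ^ k / fact k)"

text \<open>Both functions below are meaningful for \<open>0 \<le> lam < s/P\<close> only.\<close>

definition D_F :: "(nat \<Rightarrow> real) \<Rightarrow> nat \<Rightarrow> real \<Rightarrow> real" where
  "D_F q s lam =
     (if lam = 0 then 0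
      else (1 + F q (lam / real s)) / (inverse (erlang_B s lam) + F q (lam / real s)))"

definition D_FR :: "(nat \<Rightarrow> real) \<Rightarrow> nat \<Rightarrow> real \<Rightarrow> real" where
  "D_FR q s lam =
     (if lam = 0 then 0
      else (1 + (1 - real s / lam) * F q (lam / real s)) / (inverse (erlang_B s lam) + F q (lam / real s)))"

definition gamma_sF :: "(nat \<Rightarrow> real) \<Rightarrow> nat \<Rightarrow> real \<Rightarrow> real" where
  "gamma_sF q s \<epsilon> =
     (THE \<gamma>. gamma_P q s < ereal \<gamma> \<and> \<gamma> < sqrt (real s) \<and>
           sqrt (real s) * D_F q s (real s - \<gamma> * sqrt (real s)) = \<epsilon>)"

definition gamma_sFR :: "(nat \<Rightarrow> real) \<Rightarrow> nat \<Rightarrow> real \<Rightarrow> real" where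
  "gamma_sFR q s \<epsilon> =
     (THE \<gamma>. gamma_P q s < ereal \<gamma> \<and> \<gamma> < sqrt (real s) \<and>
           sqrt (real s) * D_FR q s (real s - \<gamma> * sqrt (real s)) = \<epsilon>)"

definition g_inf :: "real \<Rightarrow> real" where
  "g_inf \<gamma> = std_normal_density \<gamma> / cdf std_normal_distribution \<gamma>"

definition gamma_infF :: "(nat \<Rightarrow> real) \<Rightarrow> real \<Rightarrow> real" where
  "gamma_infF q \<epsilon> = (THE \<gamma>. (1 + F q 1) * g_inf \<gamma> = \<epsilon>)"

definition gamma_infR :: "real \<Rightarrow> real" where
  "gamma_infR \<epsilon> = (THE \<gamma>. g_inf \<gamma> = \<epsilon>)"

definition h_inf :: "real \<Rightarrow> real" where
  "h_inf \<gamma> = - (1/3) * (\<gamma> ^ 3 + (\<gamma>\<^sup>2 + 2) * g_inf \<gamma>) * g_inf \<gamma>"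

definition h_infF :: "(nat \<Rightarrow> real) \<Rightarrow> real \<Rightarrow> real" where
  "h_infF q \<gamma> =
     (1 + F q 1) * h_inf \<gamma>
     - (\<gamma> * deriv (F q) 1 + (1 + F q 1) * F q 1 * g_inf \<gamma>) * g_inf \<gamma>"

definition h_infFR :: "(nat \<Rightarrow> real) \<Rightarrow> real \<Rightarrow> real" where
  "h_infFR q \<gamma> = h_inf \<gamma> - (\<gamma> + g_inf \<gamma>) * g_inf \<gamma> * F q 1"

definition eta_infF :: "(nat \<Rightarrow> real) \<Rightarrow> real \<Rightarrow> real" where
  "eta_infF q \<epsilon> =
     - (h_infF q (gamma_infF q \<epsilon>) / ((1 + F q 1) * deriv g_inf (gamma_infF q \<epsilon>)))"

definition eta_infFR :: "(nat \<Rightarrow> real) \<Rightarrow> real \<Rightarrow> real" where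
  "eta_infFR q \<epsilon> = - (h_infFR q (gamma_infR \<epsilon>) / deriv g_inf (gamma_infR \<epsilon>))"

text \<open>Monotonic in the weak sense, in either direction.\<close>

definition D_FR_monotonic :: "(nat \<Rightarrow> real) \<Rightarrow> nat \<Rightarrow> bool" where
  "D_FR_monotonic q s \<longleftrightarrow>
     (let I = {\<gamma>. gamma_P q s < ereal \<gamma> \<and> \<gamma> \<le> sqrt (real s)};
          f = (\<lambda>\<gamma>. D_FR q s (real s - \<gamma> * sqrt (real s)))
      in mono_on I f \<or> antimono_on I f)"

end

theory Submission
  imports Defs "HOL-Real_Asymp.Real_Asymp" "HOL-Complex_Analysis.Complex_Analysis"
begin

text \<open>
  Write \<open>r = sqrt s\<close>, \<open>lam = s - \<gamma> r\<close>, \<open>x = lam / s = 1 - \<gamma> / r\<close> and \<open>I = 1 / erlang_B s lam\<close>. Clearing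
  denominators, both equations \<open>r D = \<epsilon>\<close> become linear in \<open>I\<close>: they read \<open>I = r Y(x) - F(x)\<close> with
  \<open>Y = (1 + F) / \<epsilon>\<close> for the first quantity and \<open>Y = (1 + (1 - 1/x) F) / \<epsilon>\<close> for the second. Because
  \<open>P < 1\<close>, the point \<open>x = 1\<close> lies inside the disc of convergence of \<open>F\<close>, so the right-hand side
  has a Taylor expansion at \<open>1\<close>; everything else rests on a second-order expansion of \<open>I\<close>.

  That expansion is expressed through the ratio \<open>M = 1 / g_inf\<close> of the normal distribution function
  to the density (\<open>mills\<close> below), the solution of \<open>M' = 1 + \<gamma> M\<close> that stays bounded at
  \<open>-\<infinity>\<close>. As a function of \<open>\<gamma>\<close>, the Erlang quantity satisfies a perturbation of the same
  equation,
  \<open>I' = r + \<gamma> / (1 - \<gamma> / r) I\<close>, and \<open>r M + N\<close> with \<open>N = (\<gamma>^3 M + \<gamma>^2 + 2) / 3\<close> solves it up to a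
  residual of order \<open>1 / r\<close>. The integrating factor \<open>lam^s exp (-lam)\<close> kills both functions at
  \<open>\<gamma> = -\<infinity>\<close>, so a comparison argument with an explicit supersolution of size \<open>1 / r\<close> gives
  \<open>I = r M + N + O(1 / r)\<close>, locally uniformly in \<open>\<gamma>\<close> (lemma \<open>erlang_B_expansion\<close>). No integral
  representation and no Stirling formula enter.

  Dividing the equation by \<open>r\<close> turns it into
  \<open>M(\<gamma>) - M(a) + (N(\<gamma>) + F(1) + Y'(1) \<gamma>) / r = O(1 / s)\<close>, where \<open>M(a) = Y(1)\<close>. Since \<open>M' > 0\<close>, the
  intermediate value theorem produces a solution within distance \<open>1\<close> of \<open>a\<close>, and a Newton step
  (lemma \<open>perturbed_root\<close>) gives \<open>\<gamma> = a - (N(a) + F(1) + Y'(1) a) / (r M'(a)) + O(1 / s)\<close>; rewritten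
  with \<open>g_inf = 1 / M\<close>, the coefficient is the stated one (lemmas \<open>eta_infF_eq\<close>, \<open>eta_infFR_eq\<close>).

  Finally, the solution just found must be the only one. For \<open>D_F\<close> this is strict monotonicity.
  For \<open>D_FR\<close> weak monotonicity is assumed: two solutions would make \<open>D_FR\<close> constant on an interval,
  and then, by analytic continuation in \<open>x\<close> down to \<open>x = 0\<close>, the constant would be \<open>0\<close>.
\<close>

section \<open>The reflected Mills ratio of the normal distribution\<close>

abbreviation \<Phi> :: "real \<Rightarrow> real" where "\<Phi> \<equiv> cdf std_normal_distribution"
abbreviation \<phi> :: "real \<Rightarrow> real" where "\<phi> \<equiv> std_normal_density"

lemma continuous_std_normal_density: "continuous_on A \<phi>"
  unfolding std_normal_density_def by (intro continuous_intros) auto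

lemma DERIV_std_normal_cdf: "(\<Phi> has_real_derivative \<phi> x) (at x)"
proof -
  interpret N: real_distribution std_normal_distribution
    by (rule real_dist_normal_dist)
  \<comment> \<open>The base point \<open>x - 2\<close> is moved away from \<open>x\<close> so that \<open>A\<close> has two-sided derivatives on \<open>[x - 1, x + 1]\<close>.\<close>
  define A where "A = (\<lambda>y. integral {x - 2..y} \<phi>)"
  have A: "(A has_real_derivative \<phi> y) (at y)" if "x - 2 < y" "y < x + 2" for y
  proof -
    have "(A has_real_derivative \<phi> y) (at y within {x - 2..x + 2})"
      unfolding A_def using that continuous_std_normal_density
      by (intro integral_has_real_derivative) auto
    moreover have "y \<in> interior {x - 2..x + 2}"
      using that by (simp add: interior_atLeastAtMost_real)
    ultimately show ?thesis
      by (metis at_within_interior)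
  qed
  have diff: "\<Phi> y = A y + (\<Phi> (x - 1) - A (x - 1))" if "x - 1 < y" "y < x + 1" for y
  proof -
    have "emeasure std_normal_distribution {x - 1<..y}
        = (\<integral>\<^sup>+t. ennreal (\<phi> t) * indicator {x - 1<..y} t \<partial>lborel)"
      by (subst emeasure_density) auto
    also have "\<dots> = (\<integral>\<^sup>+t. ennreal (\<phi> t) * indicator {x - 1..y} t \<partial>lborel)"
      by (intro nn_integral_cong_AE AE_I[where N = "{x - 1}"]) (auto simp: indicator_def)
    also have "\<dots> = ennreal (A y - A (x - 1))"
      by (rule nn_integral_FTC_Icc) (use that in \<open>auto intro!: A\<close>)
    finally have "emeasure std_normal_distribution {x - 1<..y} = ennreal (A y - A (x - 1))" .
    moreover have "A (x - 1) \<le> A y"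
    proof (rule DERIV_nonneg_imp_nondecreasing[of "x - 1" y])
      fix t assume "x - 1 \<le> t" "t \<le> y"
      then show "\<exists>d. (A has_real_derivative d) (at t) \<and> d \<ge> 0"
        using that by (intro exI[of _ "\<phi> t"]) (auto intro!: A)
    qed (use that in auto)
    ultimately have "measure std_normal_distribution {x - 1<..y} = A y - A (x - 1)"
      by (simp add: measure_def)
    moreover have "\<Phi> y - \<Phi> (x - 1) = measure std_normal_distribution {x - 1<..y}"
      using that by (intro N.cdf_diff_eq) auto
    ultimately show ?thesis by simp
  qed
  have "((\<lambda>y. A y + (\<Phi> (x - 1) - A (x - 1))) has_real_derivative \<phi> x) (at x)"
    using A[of x] by (auto intro!: derivative_eq_intros)
  then show ?thesis
    by (rule has_field_derivative_transform_within_open[where S = "{x - 1<..<x + 1}"])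
      (auto simp: diff)
qed

lemma DERIV_std_normal_density: "(\<phi> has_real_derivative - x * \<phi> x) (at x)"
  unfolding std_normal_density_def
  by (rule derivative_eq_intros refl | simp)+

text \<open>
  The comparison principle on a half-line. It is applied to differences of two functions that
  satisfy a linear differential (in)equality, multiplied by the integrating factor.
\<close>

lemma nonneg_of_DERIV_nonneg_at_bot:
  fixes f :: "real \<Rightarrow> real"
  assumes deriv: "\<And>x. x \<le> b \<Longrightarrow> (f has_real_derivative f' x) (at x)"
    and nonneg: "\<And>x. x \<le> b \<Longrightarrow> f' x \<ge> 0"
    and lim: "(f \<longlongrightarrow> 0) at_bot"
  shows "f b \<ge> 0"
proof -
  have "\<forall>\<^sub>F x in at_bot. f x \<le> f b"
    using eventually_le_at_bot[of b]
  proof eventually_elim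
    case (elim x)
    then show ?case
      using deriv nonneg by (intro DERIV_nonneg_imp_nondecreasing[of x b f]) blast+
  qed
  then show ?thesis
    by (intro tendsto_upperbound[OF lim]) auto
qed

lemma std_normal_cdf_at_bot: "(\<Phi> \<longlongrightarrow> 0) at_bot"
proof -
  interpret N: real_distribution std_normal_distribution
    by (rule real_dist_normal_dist)
  show ?thesis by (rule N.cdf_lim_at_bot)
qed

lemma std_normal_cdf_pos: "\<Phi> x > 0"
proof -
  have "\<Phi> (x - 1) \<ge> 0" by (simp add: cdf_def)
  moreover have "\<Phi> (x - 1) < \<Phi> x"
    by (rule DERIV_pos_imp_increasing[of "x - 1" x])
      (auto intro!: exI[of _ "\<phi> _"] DERIV_std_normal_cdf normal_density_pos)
  ultimately show ?thesis by simp
qed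

text \<open>
  The Mills ratio of the normal law, reflected: the classical ratio at \<open>-x\<close>. It is used instead of
  \<open>g_inf\<close>, its reciprocal, because its differential equation \<open>M' = 1 + x M\<close> is linear.
\<close>

definition mills :: "real \<Rightarrow> real" where "mills x = \<Phi> x / \<phi> x"

lemma g_inf_eq: "g_inf x = 1 / mills x"
  by (simp add: g_inf_def mills_def)

lemma mills_pos: "mills x > 0"
  by (simp add: mills_def std_normal_cdf_pos normal_density_pos)

lemma DERIV_mills [derivative_intros]:
  assumes "(f has_real_derivative f') (at x within S)"
  shows "((\<lambda>x. mills (f x)) has_real_derivative (1 + f x * mills (f x)) * f') (at x within S)"
proof -
  have "(mills has_real_derivative 1 + y * mills y) (at y)" for y
  proof -
    have "\<phi> y \<noteq> 0" using normal_density_pos[of 1 0 y] by simp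
    moreover from this
    have "((\<lambda>x. \<Phi> x / \<phi> x) has_real_derivative
        (\<phi> y * \<phi> y - \<Phi> y * (- y * \<phi> y)) / (\<phi> y * \<phi> y)) (at y)"
      by (intro DERIV_divide DERIV_std_normal_cdf DERIV_std_normal_density)
    moreover from \<open>\<phi> y \<noteq> 0\<close>
    have "(\<phi> y * \<phi> y - \<Phi> y * (- y * \<phi> y)) / (\<phi> y * \<phi> y) = 1 + y * mills y"
      by (simp add: mills_def field_simps)
    ultimately show ?thesis
      by (simp add: mills_def[abs_def])
  qed
  then show ?thesis using DERIV_chain2[OF _ assms] by blast
qed

lemma continuous_on_mills [continuous_intros]:
  "continuous_on S f \<Longrightarrow> continuous_on S (\<lambda>x. mills (f x))"
proof -
  have "continuous_on UNIV mills"
    using DERIV_mills[OF DERIV_ident] by (intro DERIV_continuous_on) (auto intro: has_field_derivative_at_within)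
  then show "continuous_on S f \<Longrightarrow> continuous_on S (\<lambda>x. mills (f x))"
    by (rule continuous_on_compose2) auto
qed

text \<open>
  Mills' inequality \<open>\<Phi> x < \<phi> x / \<bar>x\<bar>\<close> for \<open>x < 0\<close>: the difference of the two sides vanishes at
  \<open>-\<infinity>\<close>, and its derivative is \<open>\<phi> x / x\<^sup>2\<close>. By the differential equation it says that \<open>mills\<close> increases.
\<close>

lemma mills_deriv_pos: "1 + x * mills x > 0"
proof (cases "x < 0")
  case True
  define f where "f = (\<lambda>y. - (\<Phi> y + \<phi> y / y))"
  have f: "(f has_real_derivative \<phi> y / y\<^sup>2) (at y)" if "y < 0" for y
    unfolding f_def using that
    by (auto intro!: derivative_eq_intros DERIV_std_normal_cdf DERIV_std_normal_density
        simp: field_simps power2_eq_square)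
  have "f (x - 1) \<ge> 0"
  proof (rule nonneg_of_DERIV_nonneg_at_bot[where f = f and f' = "\<lambda>y. \<phi> y / y\<^sup>2"])
    have "((\<lambda>y. \<phi> y / y) \<longlongrightarrow> 0) at_bot"
      unfolding std_normal_density_def by real_asymp
    from tendsto_minus[OF tendsto_add[OF std_normal_cdf_at_bot this]]
    show "(f \<longlongrightarrow> 0) at_bot" by (simp add: f_def)
  qed (use f True in auto)
  also have "f (x - 1) < f x"
  proof (rule DERIV_pos_imp_increasing[of "x - 1" x])
    fix y assume "x - 1 \<le> y" "y \<le> x"
    then show "\<exists>d. (f has_real_derivative d) (at y) \<and> d > 0"
      using f[of y] True by (intro exI[of _ "\<phi> y / y\<^sup>2"]) (auto intro!: divide_pos_pos normal_density_pos)
  qed auto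
  finally have "\<Phi> x + \<phi> x / x < 0" by (simp add: f_def)
  then show ?thesis
    using True normal_density_pos[of 1 0 x] by (auto simp: mills_def field_simps)
next
  case False
  then show ?thesis using mills_pos[of x] by (simp add: add_pos_nonneg)
qed

lemma mills_strict_mono: "strict_mono mills"
proof (rule strict_monoI)
  fix x y :: real assume "x < y"
  then show "mills x < mills y"
    proof (rule DERIV_pos_imp_increasing)
    fix t
    show "\<exists>d. (mills has_real_derivative d) (at t) \<and> d > 0"
      using DERIV_mills[OF DERIV_ident, of t] mills_deriv_pos[of t] by auto
  qed
qed

text \<open>
  The bounds \<open>mills x \<le> - 1 / x\<close> for \<open>x < 0\<close> and \<open>mills x \<ge> x\<close> for \<open>x \<ge> 0\<close> bracket a preimage.
\<close>

lemma mills_surj_pos: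
  assumes "y > 0"
  obtains x where "mills x = y"
proof -
  \<comment> \<open>\<open>1 + a * mills a > 0\<close> becomes \<open>mills a < y\<close>.\<close>
  define a where "a = - 1 / y"
  have "mills a \<le> y"
    using mills_deriv_pos[of a] assms by (simp add: a_def field_simps)
  moreover have "y \<le> mills y"
  proof -
    have "mills 0 - 0 \<le> mills y - y"
    proof (rule DERIV_nonneg_imp_nondecreasing[of 0 y "\<lambda>x. mills x - x"])
      fix x assume "0 \<le> x" "x \<le> y"
      then show "\<exists>d. ((\<lambda>x. mills x - x) has_real_derivative d) (at x) \<and> d \<ge> 0"
        using mills_pos[of x]
        by (intro exI[of _ "x * mills x"]) (auto intro!: derivative_eq_intros)
    qed (use assms in auto)
    then show ?thesis using mills_pos[of 0] by simp
  qed
  moreover have "a \<le> y" using assms 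
    by (intro order_trans[of a 0 y]) (auto simp: a_def)
  ultimately have "\<exists>x. a \<le> x \<and> x \<le> y \<and> mills x = y"
    by (intro IVT' continuous_intros)
  then show ?thesis using that by auto
qed

lemma the_mills_eq: "(THE x. mills x = mills a) = a"
  by (rule the_equality) (auto dest: strict_mono_eq[OF mills_strict_mono, THEN iffD1])

lemma deriv_g_inf: "deriv g_inf x = - (1 + x * mills x) / (mills x)\<^sup>2"
proof (rule DERIV_imp_deriv)
  have "((\<lambda>x. 1 / mills x) has_real_derivative - (1 + x * mills x) / (mills x)\<^sup>2) (at x)"
    using mills_pos[of x] by (auto intro!: derivative_eq_intros simp: power2_eq_square)
  then show "(g_inf has_real_derivative - (1 + x * mills x) / (mills x)\<^sup>2) (at x)"
    by (simp add: g_inf_eq[abs_def])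
qed

section \<open>Expansion of the reciprocal Erlang B function\<close>

text \<open>
  The second-order term \<open>N\<close> in the expansion of the reciprocal Erlang B function. It is the solution
  of \<open>N' = x N + x\<^sup>2 M\<close> that grows at most polynomially at \<open>-\<infinity>\<close>; the source term
  \<open>x\<^sup>2 M\<close> comes from \<open>x / (1 - x / r) = x + x\<^sup>2 / r + \<dots>\<close>.
\<close>

definition erlang_corr :: "real \<Rightarrow> real" where
  "erlang_corr x = (x ^ 3 * mills x + x\<^sup>2 + 2) / 3"

lemma DERIV_erlang_corr [derivative_intros]:
  assumes "(f has_real_derivative f') (at x within S)"
  shows "((\<lambda>x. erlang_corr (f x)) has_real_derivative
    ((f x)\<^sup>2 * mills (f x) + f x * erlang_corr (f x)) * f') (at x within S)"
  unfolding erlang_corr_def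
  by (rule derivative_eq_intros assms refl | simp)+
    (simp add: field_simps power2_eq_square power3_eq_cube)

lemma abs_mult_mills_le: "x \<le> 0 \<Longrightarrow> \<bar>x * mills x\<bar> \<le> 1"
  using mills_deriv_pos[of x] mills_pos[of x] by (simp add: abs_mult)

lemma mills_le_1: "x \<le> -1 \<Longrightarrow> mills x \<le> 1"
  using strict_mono_less_eq[OF mills_strict_mono, of x "-1"] mills_deriv_pos[of "-1"] by simp

text \<open>
  The sum telescopes; this is the differential equation of the incomplete Gamma function.
\<close>

lemma DERIV_exp_partial_sum:
  "((\<lambda>x::real. exp (- x) * (\<Sum>k=0..n. x ^ k / fact k)) has_real_derivative - exp (- x) * x ^ n / fact n) (at x)"
proof (induction n)
  case 0
  show ?case by (auto intro!: derivative_eq_intros)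
next
  case (Suc n)
  have pow: "((\<lambda>x::real. x ^ Suc n / fact (Suc n)) has_real_derivative x ^ n / fact n) (at x)"
  proof -
    have "((\<lambda>x::real. x ^ Suc n / fact (Suc n)) has_real_derivative
        real (Suc n) * x ^ n / fact (Suc n)) (at x)"
      using DERIV_cdivide[OF DERIV_pow[of "Suc n" x UNIV], of "fact (Suc n)"] by (simp only: diff_Suc_1 One_nat_def[symmetric])
    then show ?thesis by (simp add: divide_simps del: of_nat_Suc)
  qed
  have ex: "((\<lambda>x::real. exp (- x)) has_real_derivative - exp (- x)) (at x)"
    by (auto intro!: derivative_eq_intros)
  have "((\<lambda>x::real. exp (- x) * (\<Sum>k=0..n. x ^ k / fact k) + exp (- x) * (x ^ Suc n / fact (Suc n)))
     has_real_derivative - exp (- x) * x ^ n / fact n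
       + (- exp (- x) * (x ^ Suc n / fact (Suc n)) + x ^ n / fact n * exp (- x))) (at x)"
    by (intro DERIV_add[OF Suc] DERIV_mult[OF ex pow])
  then show ?case by (simp add: algebra_simps)
qed

text \<open>
  With the integrating factor \<open>lam ^ s * exp (- lam)\<close>, the reciprocal of the Erlang B function becomes
  a Poisson partial sum, whose derivative is known.
\<close>

lemma inverse_erlang_B:
  "lam > 0 \<Longrightarrow> inverse (erlang_B s lam) * (lam ^ s * exp (- lam))
     = fact s * (exp (- lam) * (\<Sum>k=0..s. lam ^ k / fact k))"
  by (simp add: erlang_B_def field_simps)

lemma tendsto_power_mult_exp_minus: "((\<lambda>x::real. x ^ n * exp (- x)) \<longlongrightarrow> 0) at_top"
  using tendsto_power_div_exp_0[of n] by (simp add: exp_minus field_simps)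

text \<open>
  For \<open>x \<le> -1\<close> every coefficient is dominated by a multiple of \<open>x ^ 4\<close>, hence of \<open>lam ^ 4\<close> with
  \<open>lam = r\<^sup>2 - x r\<close>, and the exponential wins as \<open>lam\<close> tends to infinity.
\<close>

lemma barrier_at_bot:
  fixes A r :: real and W :: "real \<Rightarrow> real" and s :: nat
  assumes r: "r \<ge> 1" and A: "A \<ge> 0"
    and W: "\<And>x. x \<le> -1 \<Longrightarrow> \<bar>W x\<bar> \<le> A * x ^ 4"
    and \<sigma>: "\<bar>\<sigma>\<bar> \<le> 1"
  shows "((\<lambda>x. (\<sigma> * (r * mills x + erlang_corr x) + W x) * ((r\<^sup>2 - x * r) ^ s * exp (- (r\<^sup>2 - x * r)))
     - \<sigma> * (fact s * (exp (- (r\<^sup>2 - x * r)) * (\<Sum>k=0..s. (r\<^sup>2 - x * r) ^ k / fact k)))) \<longlongrightarrow> 0) at_bot"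
    (is "(?f \<longlongrightarrow> 0) at_bot")
proof (rule Lim_null_comparison)
  let ?l = "\<lambda>x. r\<^sup>2 - x * r"
  let ?g = "\<lambda>l::real. (r + 2 + A) * (l ^ (s + 4) * exp (- l)) + fact s * (\<Sum>k=0..s. l ^ k * exp (- l) / fact k)"
  have "(?g \<longlongrightarrow> (r + 2 + A) * 0 + fact s * (\<Sum>k=0..s. 0 / fact k)) at_top"
    by (intro tendsto_intros tendsto_power_mult_exp_minus) auto
  moreover have "filterlim ?l at_top at_bot"
    using r by real_asymp
  ultimately have "((\<lambda>x. ?g (?l x)) \<longlongrightarrow> (r + 2 + A) * 0 + fact s * (\<Sum>k=0..s. 0 / fact k)) at_bot"
    by (rule filterlim_compose)
  then show "((\<lambda>x. ?g (?l x)) \<longlongrightarrow> 0) at_bot" by simp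
  show "\<forall>\<^sub>F x in at_bot. norm (?f x) \<le> ?g (?l x)"
    using eventually_le_at_bot[of "-1"]
  proof eventually_elim
    case (elim x)
    define l where "l = ?l x"
    have "1 * \<bar>x\<bar> \<le> r * \<bar>x\<bar>" using r by (intro mult_right_mono) auto
    then have l: "\<bar>x\<bar> \<le> l" "l \<ge> 1"
    proof -
      have "r * \<bar>x\<bar> = - (x * r)" using elim by simp
      moreover have "0 \<le> r\<^sup>2" by simp
      ultimately show "\<bar>x\<bar> \<le> l" using \<open>1 * \<bar>x\<bar> \<le> r * \<bar>x\<bar>\<close> unfolding l_def by linarith
      then show "l \<ge> 1" using elim by simp
    qed
    have x4: "x\<^sup>2 \<le> x ^ 4" "1 \<le> x\<^sup>2"
    proof -
      show 1: "1 \<le> x\<^sup>2" using elim power_mono[of 1 "- x" 2] by simp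
      have "x\<^sup>2 * 1 \<le> x\<^sup>2 * x\<^sup>2" by (intro mult_left_mono 1) auto
      then show "x\<^sup>2 \<le> x ^ 4" by (simp flip: power_add)
    qed
    have x4l: "x ^ 4 \<le> l ^ 4"
      using power_mono[OF l(1), of 4] by simp
    have xm: "\<bar>x * mills x\<bar> \<le> 1" using elim by (intro abs_mult_mills_le) auto
    have m: "mills x \<le> 1" using elim by (rule mills_le_1)
    have "\<bar>x ^ 3 * mills x\<bar> = x\<^sup>2 * \<bar>x * mills x\<bar>"
      by (simp add: abs_mult power2_eq_square power3_eq_cube)
    also have "\<dots> \<le> x\<^sup>2 * 1" by (intro mult_left_mono xm) auto
    finally have "\<bar>erlang_corr x\<bar> \<le> 2 * x ^ 4"
      using x4 unfolding erlang_corr_def by (auto simp: abs_if field_simps split: if_splits)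
    moreover have "r * mills x \<le> r * x ^ 4"
      using r m x4 by (intro mult_left_mono) auto
    moreover have "0 \<le> r * mills x"
      using mills_pos[of x] r by simp
    moreover have "(r + 2) * x ^ 4 = r * x ^ 4 + 2 * x ^ 4" by (simp add: algebra_simps)
    ultimately have "\<bar>r * mills x + erlang_corr x\<bar> \<le> (r + 2) * x ^ 4"
      by linarith
    then have "\<bar>\<sigma>\<bar> * \<bar>r * mills x + erlang_corr x\<bar> \<le> 1 * ((r + 2) * x ^ 4)"
      using \<sigma> by (intro mult_mono) auto
    then have "\<bar>\<sigma> * (r * mills x + erlang_corr x) + W x\<bar> \<le> (r + 2) * x ^ 4 + A * x ^ 4"
      using W[OF elim] by (intro order_trans[OF abs_triangle_ineq] add_mono) (auto simp: abs_mult)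
    also have "\<dots> = (r + 2 + A) * x ^ 4" by (simp add: algebra_simps)
    also have "\<dots> \<le> (r + 2 + A) * l ^ 4"
      using r A x4l by (intro mult_left_mono) auto
    finally have "\<bar>\<sigma> * (r * mills x + erlang_corr x) + W x\<bar> * (l ^ s * exp (- l))
        \<le> (r + 2 + A) * l ^ 4 * (l ^ s * exp (- l))"
      using l by (intro mult_right_mono) auto
    moreover have "\<bar>\<sigma>\<bar> * (fact s * (exp (- l) * (\<Sum>k=0..s. l ^ k / fact k)))
        \<le> 1 * (fact s * (exp (- l) * (\<Sum>k=0..s. l ^ k / fact k)))"
      using \<sigma> l by (intro mult_right_mono mult_nonneg_nonneg sum_nonneg) auto
    ultimately have "norm (?f x) \<le> (r + 2 + A) * l ^ 4 * (l ^ s * exp (- l))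
        + fact s * (exp (- l) * (\<Sum>k=0..s. l ^ k / fact k))"
      unfolding l_def[symmetric] real_norm_def
      using l
      by (intro order_trans[OF abs_triangle_ineq4] add_mono) (auto simp: abs_mult sum_nonneg)
    also have "\<dots> = ?g l"
      by (simp add: power_add sum_distrib_left mult_ac)
    finally show ?case by (simp add: l_def)
  qed
qed

text \<open>
  The function differentiated is \<open>(\<sigma> (r M + N - I) + W)\<close> times the integrating factor, \<open>\<sigma>\<close> being a
  sign. The main terms cancel by the choice of \<open>N\<close>: what is left of \<open>r M + N\<close> is the residual
  \<open>x ^ 3 M + x\<^sup>2 N\<close> alone, no longer multiplied by \<open>r\<close>.
\<close>

lemma barrier_derivative:
  fixes x r :: real and s :: nat
  assumes s: "s \<ge> 1" and r: "r = sqrt (real s)" and x: "x < r"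
    and W: "(W has_real_derivative W') (at x)"
  shows "((\<lambda>x. (\<sigma> * (r * mills x + erlang_corr x) + W x) * ((r\<^sup>2 - x * r) ^ s * exp (- (r\<^sup>2 - x * r)))
     - \<sigma> * (fact s * (exp (- (r\<^sup>2 - x * r)) * (\<Sum>k=0..s. (r\<^sup>2 - x * r) ^ k / fact k))))
     has_real_derivative
      (r\<^sup>2 - x * r) ^ s * exp (- (r\<^sup>2 - x * r)) / (r - x)
       * ((r - x) * W' - r * x * W x - \<sigma> * (x ^ 3 * mills x + x\<^sup>2 * erlang_corr x))) (at x)"
proof -
  have r0: "r > 0" and rr: "real s = r\<^sup>2" using s r by auto
  define l where "l = (\<lambda>x. r\<^sup>2 - x * r)"
  have l: "(l has_real_derivative - r) (at x)"
    unfolding l_def by (auto intro!: derivative_eq_intros)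
  have lr: "l x = r * (r - x)" by (simp add: l_def algebra_simps power2_eq_square)
  have lpos: "l x > 0" using x r0 by (simp add: lr)
  define \<rho> where "\<rho> = l x ^ s * exp (- l x)"
  have pow: "real s * l x ^ (s - 1) * (r - x) = r * l x ^ s"
  proof -
    have "l x ^ s = l x * l x ^ (s - 1)" using s by (simp add: power_eq_if)
    then show ?thesis by (simp add: lr rr power2_eq_square)
  qed
  have \<rho>: "((\<lambda>x. l x ^ s * exp (- l x)) has_real_derivative - (r * x / (r - x)) * \<rho>) (at x)"
  proof -
    have "((\<lambda>x. l x ^ s * exp (- l x)) has_real_derivative
        (real s * l x ^ (s - 1) * - r) * exp (- l x) + (exp (- l x) * - (- r)) * l x ^ s) (at x)"
      by (rule derivative_eq_intros l refl | simp)+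
    moreover have pow': "real s * l x ^ (s - 1) = r * l x ^ s / (r - x)"
      using pow x by (simp add: field_simps)
    have "(real s * l x ^ (s - 1) * - r) * exp (- l x) + (exp (- l x) * - (- r)) * l x ^ s
        = - (r * x / (r - x)) * \<rho>"
      unfolding pow' \<rho>_def using x by (simp add: field_simps)
    ultimately show ?thesis by simp
  qed
  have T: "((\<lambda>x. fact s * (exp (- l x) * (\<Sum>k=0..s. l x ^ k / fact k))) has_real_derivative r * \<rho>) (at x)"
  proof -
    have "((\<lambda>x. fact s * (exp (- l x) * (\<Sum>k=0..s. l x ^ k / fact k))) has_real_derivative
       fact s * ((- exp (- l x) * l x ^ s / fact s) * - r)) (at x)"
      by (intro DERIV_cmult DERIV_chain2[OF DERIV_exp_partial_sum l])
    then show ?thesis by (simp add: \<rho>_def mult_ac)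
  qed
  have K: "((\<lambda>x. \<sigma> * (r * mills x + erlang_corr x) + W x) has_real_derivative
      \<sigma> * (r * (1 + x * mills x) + (x\<^sup>2 * mills x + x * erlang_corr x)) + W') (at x)"
    by (rule derivative_eq_intros refl W | simp)+
  have "((\<lambda>x. (\<sigma> * (r * mills x + erlang_corr x) + W x) * (l x ^ s * exp (- l x))
     - \<sigma> * (fact s * (exp (- l x) * (\<Sum>k=0..s. l x ^ k / fact k))))
     has_real_derivative
       (\<sigma> * (r * (1 + x * mills x) + (x\<^sup>2 * mills x + x * erlang_corr x)) + W') * \<rho>
       + - (r * x / (r - x)) * \<rho> * (\<sigma> * (r * mills x + erlang_corr x) + W x)
       - \<sigma> * (r * \<rho>)) (at x)" (is "(_ has_real_derivative ?D) _")
    using DERIV_diff[OF DERIV_mult[OF K \<rho>] DERIV_cmult[OF T]] by (simp add: \<rho>_def)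
  moreover have "?D = \<rho> / (r - x) * ((r - x) * W' - r * x * W x - \<sigma> * (x ^ 3 * mills x + x\<^sup>2 * erlang_corr x))"
    using x by (simp add: field_simps) (simp add: algebra_simps power2_eq_square power3_eq_cube)
  ultimately show ?thesis
    unfolding l_def \<rho>_def by metis
qed

text \<open>
  A barrier \<open>W\<close> whose growth dominates the residual confines \<open>r M + N - I\<close> to \<open>[-W, W]\<close>: apply the
  comparison principle to the function of the preceding lemma with both signs \<open>\<sigma>\<close>.
\<close>

lemma erlang_B_bound_of_barrier:
  fixes A b r :: real and W :: "real \<Rightarrow> real" and s :: nat
  assumes s: "s \<ge> 1" and r: "r = sqrt (real s)" and b: "b < r"
    and W: "\<And>x. x \<le> b \<Longrightarrow> (W has_real_derivative W' x) (at x)"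
    and bnd: "A \<ge> 0" "\<And>x. x \<le> -1 \<Longrightarrow> \<bar>W x\<bar> \<le> A * x ^ 4"
    and barrier: "\<And>x. x \<le> b \<Longrightarrow>
       \<bar>x ^ 3 * mills x + x\<^sup>2 * erlang_corr x\<bar> \<le> (r - x) * W' x - r * x * W x"
  shows "\<bar>inverse (erlang_B s (real s - b * r)) - (r * mills b + erlang_corr b)\<bar> \<le> W b"
proof -
  have r1: "r \<ge> 1" and rr: "real s = r\<^sup>2" using s r by auto
  define l where "l = r\<^sup>2 - b * r"
  have lpos: "l > 0" using b r1 by (simp add: l_def power2_eq_square)
  define I where "I = inverse (erlang_B s l)"
  have *: "0 \<le> (\<sigma> * (r * mills b + erlang_corr b) + W b) * (l ^ s * exp (- l)) - \<sigma> * (I * (l ^ s * exp (- l)))"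
    if \<sigma>: "\<bar>\<sigma>\<bar> = 1" for \<sigma>
    unfolding I_def inverse_erlang_B[OF lpos] unfolding l_def
  proof (rule nonneg_of_DERIV_nonneg_at_bot[OF barrier_derivative[OF s r _ W] _ barrier_at_bot[OF r1 bnd]])
    fix x assume x: "x \<le> b"
    have "\<sigma> * (x ^ 3 * mills x + x\<^sup>2 * erlang_corr x) \<le> \<bar>x ^ 3 * mills x + x\<^sup>2 * erlang_corr x\<bar>"
      using \<sigma> by (metis abs_ge_self abs_mult mult_1)
    then have "0 \<le> (r - x) * W' x - r * x * W x - \<sigma> * (x ^ 3 * mills x + x\<^sup>2 * erlang_corr x)"
      using barrier[OF x] by linarith
    moreover have "0 \<le> r\<^sup>2 - x * r" using x b r1 by (simp add: power2_eq_square)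
    ultimately show "0 \<le> (r\<^sup>2 - x * r) ^ s * exp (- (r\<^sup>2 - x * r)) / (r - x)
       * ((r - x) * W' x - r * x * W x - \<sigma> * (x ^ 3 * mills x + x\<^sup>2 * erlang_corr x))"
      using x b by (intro mult_nonneg_nonneg divide_nonneg_nonneg) auto
  qed (use b \<sigma> in auto)
  have "0 \<le> (\<sigma> * (r * mills b + erlang_corr b) + W b - \<sigma> * I)" if "\<bar>\<sigma>\<bar> = 1" for \<sigma>
  proof -
    have "0 \<le> (\<sigma> * (r * mills b + erlang_corr b) + W b - \<sigma> * I) * (l ^ s * exp (- l))"
      using *[OF that] by (simp add: algebra_simps)
    moreover have "l ^ s * exp (- l) > 0" using lpos by simp
    ultimately show ?thesis by (simp add: zero_le_mult_iff)
  qed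
  from this[of 1] this[of "-1"] show ?thesis
    by (simp add: I_def l_def rr abs_le_iff)
qed

text \<open>
  The inequality that lets the polynomial part of the barrier dominate the residual at \<open>x = - t\<close>. Any
  large constant serves; for \<open>t \<le> 6\<close> the left-hand side is at most \<open>1236\<close>, and beyond that \<open>t ^ 4\<close> suffices.
\<close>

lemma barrier_polynomial:
  fixes t :: real
  assumes "t \<ge> 0"
  shows "5 * t ^ 3 + 4 * t\<^sup>2 + 2 * t \<le> 1300 + t ^ 4"
proof (cases "t \<le> 6")
  case True
  have "t\<^sup>2 \<le> 36" "t ^ 3 \<le> 216"
    using power_mono[OF True assms, of 2] power_mono[OF True assms, of 3] by simp_all
  moreover have "0 \<le> t ^ 4" using assms by simp
  ultimately show ?thesis using True by linarith
next
  case False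
  have "t * 6 \<le> t * t" "t\<^sup>2 * 6 \<le> t\<^sup>2 * t" "t ^ 3 * 6 \<le> t ^ 3 * t"
    by (rule mult_left_mono; use False in simp)+
  moreover have "t * t = t\<^sup>2" "t\<^sup>2 * t = t ^ 3" "t ^ 3 * t = t ^ 4"
    by (simp_all add: power2_eq_square power3_eq_cube power4_eq_xxxx)
  ultimately show ?thesis using False by linarith
qed

text \<open>
  The residual formally has degree five in \<open>x\<close>, but \<open>0 \<le> 1 + x M \<le> 1\<close> for \<open>x \<le> 0\<close> lowers the degree
  to four, which the barrier \<open>1300 + x ^ 4\<close> can absorb.
\<close>

lemma residual_bound_nonpos:
  fixes x :: real
  assumes "x \<le> 0"
  shows "\<bar>x ^ 3 * mills x + x\<^sup>2 * erlang_corr x\<bar> \<le> 2 * x\<^sup>2 + x ^ 4"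
proof -
  define u where "u = 1 + x * mills x"
  have u: "0 \<le> u" "u \<le> 1"
    using mills_deriv_pos[of x] mills_pos[of x] assms
    by (auto simp: u_def mult_nonpos_nonneg)
  have "x ^ 3 * mills x + x\<^sup>2 * erlang_corr x = x\<^sup>2 * (u - 1 / 3) + x ^ 4 * (u / 3)"
    by (simp add: u_def erlang_corr_def field_simps power2_eq_square power3_eq_cube power4_eq_xxxx)
  also have "\<bar>\<dots>\<bar> \<le> x\<^sup>2 * 2 + x ^ 4 * 1"
    using u by (intro order_trans[OF abs_triangle_ineq] add_mono) (auto simp: abs_mult intro!: mult_left_mono)
  finally show ?thesis by simp
qed

text \<open>
  The barrier is \<open>(1300 + x ^ 4 + L M) / r\<close>. For negative \<open>x\<close> the polynomial part, on which the term
  \<open>- x W\<close> acts with a favourable sign, dominates the residual. On \<open>[0, b]\<close> this sign is lost, but there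
  all terms are bounded, and \<open>M\<close> contributes \<open>(1 - x / r) M' - x M \<ge> 1 / 2\<close> for large \<open>r\<close>; hence a large
  multiple \<open>L\<close> of \<open>M\<close>, which does no harm for negative \<open>x\<close>, compensates.
\<close>

lemma erlang_B_expansion:
  fixes b :: real
  assumes b: "b \<ge> 0"
  shows "\<exists>C s0. \<forall>s\<ge>s0. \<forall>x. \<bar>x\<bar> \<le> b \<longrightarrow>
    \<bar>inverse (erlang_B s (real s - x * sqrt (real s)))
       - (sqrt (real s) * mills x + erlang_corr x)\<bar> \<le> C / sqrt (real s)"
proof -
  define C1 where "C1 = b ^ 3 * mills b + b\<^sup>2 * erlang_corr b"
  define C2 where "C2 = b * (1300 + b ^ 4)"
  \<comment> \<open>On \<open>[0, b]\<close>, \<open>C1\<close> bounds the residual and \<open>C2\<close> the loss caused by the polynomial part.\<close>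
  define L where "L = 2 * (C1 + C2)"
  have mono: "mills x \<le> mills b" if "x \<le> b" for x
    using strict_mono_less_eq[OF mills_strict_mono] that by simp
  have C1: "\<bar>x ^ 3 * mills x + x\<^sup>2 * erlang_corr x\<bar> \<le> C1" if "0 \<le> x" "x \<le> b" for x
  proof -
    have "x ^ 3 * mills x \<le> b ^ 3 * mills b"
      using that mono mills_pos[of x] by (intro mult_mono power_mono) auto
    moreover from this have "erlang_corr x \<le> erlang_corr b"
      using power_mono[OF that(2,1), of 2] unfolding erlang_corr_def by (intro divide_right_mono add_mono) auto
    moreover have "erlang_corr x \<ge> 0"
      using that mills_pos[of x] by (simp add: erlang_corr_def)
    ultimately show ?thesis
      using that mills_pos[of x] b unfolding C1_def
      by (subst abs_of_nonneg) (auto intro!: add_mono mult_mono power_mono add_nonneg_nonneg mult_nonneg_nonneg)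
  qed
  have L: "L \<ge> 0"
    using C1[of 0] b unfolding L_def C2_def by simp
  \<comment> \<open>The size of \<open>r\<close> from which on \<open>(1 - x / r) M' - x M = 1 - x M' / r \<ge> 1 / 2\<close> on \<open>[0, b]\<close>.\<close>
  define r0 where "r0 = 1 + 2 * (b * (1 + b * mills b))"
  define C where "C = 1300 + b ^ 4 + L * mills b"
  have "\<bar>inverse (erlang_B s (real s - y * r)) - (r * mills y + erlang_corr y)\<bar> \<le> C / r"
    if s: "s \<ge> 1" "r = sqrt (real s)" "r \<ge> r0" and y: "\<bar>y\<bar> \<le> b" for s r y
  proof -
    have bb: "b * 1 \<le> b * (1 + b * mills b)" using b mills_pos[of b] by (intro mult_left_mono) auto
    have r1: "r \<ge> 1" and br: "b < r" and b2: "b * (1 + b * mills b) \<le> r / 2"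
      using bb s b by (auto simp: r0_def)
    define W where "W = (\<lambda>x. (1300 + x ^ 4 + L * mills x) / r)"
    have "\<bar>inverse (erlang_B s (real s - y * r)) - (r * mills y + erlang_corr y)\<bar> \<le> W y"
    proof (rule erlang_B_bound_of_barrier[OF s(1,2)])
      show "y < r" using y br by simp
      show "(W has_real_derivative (4 * x ^ 3 + L * (1 + x * mills x)) / r) (at x)" for x
        unfolding W_def using r1 by (auto intro!: derivative_eq_intros)
      show "0 \<le> 1301 + L" using L by simp
      show "\<bar>W x\<bar> \<le> (1301 + L) * x ^ 4" if x: "x \<le> -1" for x
      proof -
        have x4: "1 \<le> x ^ 4"
          using power_mono[of 1 "- x" 4] x by simp
        have m: "mills x \<le> 1" using x by (rule mills_le_1)
        have "L * mills x \<le> L * x ^ 4"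
          using L m x4 by (intro mult_left_mono) auto
        then have "1300 + x ^ 4 + L * mills x \<le> (1301 + L) * x ^ 4 * 1"
          using x4 by (simp add: algebra_simps)
        also have "\<dots> \<le> (1301 + L) * x ^ 4 * r"
          using L r1 by (intro mult_left_mono) auto
        finally show ?thesis
          using r1 L mills_pos[of x] unfolding W_def by (simp add: divide_simps)
      qed
      fix x assume "x \<le> y"
      then have xb: "x \<le> b" using y by simp
      have "(r - x) * ((4 * x ^ 3 + L * (1 + x * mills x)) / r) - r * x * W x
          = 4 * x ^ 3 * (1 - x / r) - x * (1300 + x ^ 4) + L * (1 - x * (1 + x * mills x) / r)"
        unfolding W_def using r1 by (simp add: field_simps)
      also have "\<bar>x ^ 3 * mills x + x\<^sup>2 * erlang_corr x\<bar> \<le> \<dots>"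
      proof (cases "x \<le> 0")
        case True
        have "x * (1 + x * mills x) \<le> 0"
          using True mills_deriv_pos[of x] by (simp add: mult_nonpos_nonneg)
        then have "x * (1 + x * mills x) / r \<le> 0"
          using r1 by (simp add: divide_nonpos_pos)
        then have 1: "L * (1 - x * (1 + x * mills x) / r) \<ge> 0"
          using L by (intro mult_nonneg_nonneg) auto
        define t where "t = - x"
        have t: "t \<ge> 0" "x = - t" using True by (auto simp: t_def)
        have "t ^ 4 / r \<le> t ^ 4 / 1"
          using r1 t by (intro divide_left_mono) auto
        moreover have "t * (5 * t ^ 3 + 4 * t\<^sup>2 + 2 * t) \<le> t * (1300 + t ^ 4)"
          using t by (intro mult_left_mono barrier_polynomial)
        moreover have "4 * x ^ 3 * (1 - x / r) - x * (1300 + x ^ 4)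
            = - 4 * t ^ 3 - 4 * (t ^ 4 / r) + t * (1300 + t ^ 4)"
          unfolding t(2) by (simp add: field_simps power2_eq_square power3_eq_cube power4_eq_xxxx)
        moreover have "t * (5 * t ^ 3 + 4 * t\<^sup>2 + 2 * t) = 5 * t ^ 4 + 4 * t ^ 3 + 2 * t\<^sup>2"
          by (simp add: field_simps power2_eq_square power3_eq_cube power4_eq_xxxx)
        ultimately have "4 * x ^ 3 * (1 - x / r) - x * (1300 + x ^ 4) \<ge> 2 * t\<^sup>2 + t ^ 4"
          by linarith
        then show ?thesis
          using 1 residual_bound_nonpos[OF True] by (simp add: t)
      next
        case False
        have "x * (1 + x * mills x) \<le> b * (1 + b * mills b)"
          using False xb mono[OF xb] mills_pos[of x] by (intro mult_mono add_mono) auto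
        then have "x * (1 + x * mills x) / r \<le> 1 / 2"
          using b2 r1 by (simp add: field_simps)
        then have "L * (1 / 2) \<le> L * (1 - x * (1 + x * mills x) / r)"
          using L by (intro mult_left_mono) auto
        moreover have "4 * x ^ 3 * (1 - x / r) \<ge> 0"
          using False xb br r1 by (intro mult_nonneg_nonneg) auto
        moreover have "x * (1300 + x ^ 4) \<le> C2"
          using False xb unfolding C2_def by (intro mult_mono add_mono power_mono) auto
        moreover have "\<bar>x ^ 3 * mills x + x\<^sup>2 * erlang_corr x\<bar> \<le> C1"
          using False xb by (intro C1) auto
        ultimately show ?thesis
          unfolding L_def by argo
      qed
      finally show "\<bar>x ^ 3 * mills x + x\<^sup>2 * erlang_corr x\<bar>
          \<le> (r - x) * ((4 * x ^ 3 + L * (1 + x * mills x)) / r) - r * x * W x" .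
    qed
    also have "W y \<le> C / r"
    proof -
      have "y ^ 4 \<le> b ^ 4" using power_mono[OF y, of 4] by simp
      moreover have "L * mills y \<le> L * mills b"
        using L mono[of y] y by (intro mult_left_mono) auto
      ultimately show ?thesis
        unfolding W_def C_def using r1 by (intro divide_right_mono add_mono) auto
    qed
    finally show ?thesis .
  qed
  moreover have "s \<ge> 1" "sqrt (real s) \<ge> r0" if "s \<ge> Suc (nat \<lceil>r0\<^sup>2\<rceil>)" for s
  proof -
    show "s \<ge> 1" using that by simp
    have "r0\<^sup>2 \<le> real s" using that by linarith
    then show "sqrt (real s) \<ge> r0" by (simp add: real_le_rsqrt)
  qed
  ultimately show ?thesis
    by (intro exI[of _ C] exI[of _ "Suc (nat \<lceil>r0\<^sup>2\<rceil>)"]) blast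
qed

section \<open>The power series of the admission policy and uniqueness of the thresholds\<close>

text \<open>
  The power series \<open>F\<close>. The coefficient ring is left open because the derivative is taken over
  the reals and the identity theorem is applied over the complex numbers.
\<close>

definition policy_fps :: "(nat \<Rightarrow> real) \<Rightarrow> 'a::{banach, real_normed_field} fps" where
  "policy_fps q = Abs_fps (\<lambda>n. if n = 0 then 0 else of_real (\<Prod>i<n. q i))"

lemma policy_fps_nth_0 [simp]: "fps_nth (policy_fps q) 0 = 0"
  by (simp add: policy_fps_def)

lemma ereal_less_mono: "ereal y < R \<Longrightarrow> x \<le> y \<Longrightarrow> ereal x < R"
  by (metis ereal_less_eq(3) order_le_less_trans)

context
  fixes q :: "nat \<Rightarrow> real"
  assumes q: "\<And>n. q n \<in> {0..1}"
begin

lemma policy_prod_bounds: "0 \<le> (\<Prod>i\<in>A. q i)" "(\<Prod>i\<in>A. q i) \<le> 1"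
  using q by (auto intro!: prod_nonneg prod_le_1)

lemma P_lim_bounds: "0 \<le> P_lim q" "P_lim q \<le> 1"
  and ereal_P_lim: "limsup (\<lambda>n. ereal (root (n + 1) (\<Prod>i\<le>n. q i))) = ereal (P_lim q)"
proof -
  define L where "L = limsup (\<lambda>n. ereal (root (n + 1) (\<Prod>i\<le>n. q i)))"
  have "L \<le> 1"
    unfolding L_def using real_root_le_mono[OF _ policy_prod_bounds(2), of "Suc _"]
    by (intro Limsup_bounded always_eventually allI) (simp add: one_ereal_def)
  moreover have "0 \<le> L"
    unfolding L_def using policy_prod_bounds(1)
    by (intro le_Limsup always_eventually allI) (auto simp: real_root_ge_zero)
  ultimately show "L = ereal (P_lim q)" "0 \<le> P_lim q" "P_lim q \<le> 1"
    unfolding P_lim_def L_def[symmetric] by (cases L; auto simp: one_ereal_def zero_ereal_def)+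
qed

lemma policy_fps_conv_radius:
  "fps_conv_radius (policy_fps q :: 'a::{banach, real_normed_field} fps) = inverse (ereal (P_lim q))"
proof -
  let ?u = "\<lambda>n. ereal (root n (norm (fps_nth (policy_fps q :: 'a fps) n)))"
  have "limsup ?u = limsup (\<lambda>n. ?u (n + 1))"
    by (rule limsup_shift[symmetric])
  also have "(\<lambda>n. ?u (n + 1)) = (\<lambda>n. ereal (root (n + 1) (\<Prod>i\<le>n. q i)))"
    using policy_prod_bounds(1) by (simp add: policy_fps_def lessThan_Suc_atMost del: of_real_prod)
  finally have "limsup ?u = ereal (P_lim q)"
    by (simp only: ereal_P_lim)
  then show ?thesis
    by (simp add: fps_conv_radius_def conv_radius_def)
qed

lemma eval_policy_fps:
  fixes x :: real
  assumes "ereal \<bar>x\<bar> < inverse (ereal (P_lim q))"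
  shows "eval_fps (policy_fps q) (of_real x :: 'a::{banach, real_normed_field}) = of_real (F q x)"
proof -
  let ?f = "policy_fps q :: real fps"
  have sum: "summable (\<lambda>n. fps_nth ?f n * x ^ n)"
    using assms by (intro summable_fps) (simp add: policy_fps_conv_radius)
  have "F q x = (\<Sum>n. fps_nth ?f (Suc n) * x ^ Suc n)"
    by (simp add: F_def policy_fps_def lessThan_Suc_atMost)
  also have "\<dots> = (\<Sum>n. fps_nth ?f n * x ^ n)"
    using suminf_split_head[OF sum] by simp
  finally have "of_real (F q x) = (\<Sum>n. of_real (fps_nth ?f n * x ^ n) :: 'a)"
    using suminf_of_real[OF sum] by simp
  also have "\<dots> = eval_fps (policy_fps q) (of_real x)"
    unfolding eval_fps_def by (intro arg_cong[where f = suminf] ext) (simp add: policy_fps_def del: of_real_prod)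
  finally show ?thesis ..
qed

lemma F_eq_eval_fps:
  "ereal \<bar>x\<bar> < inverse (ereal (P_lim q)) \<Longrightarrow> F q x = eval_fps (policy_fps q) x"
  using eval_policy_fps[of x, where 'a = real] by simp

lemma policy_fps_nth_nonneg: "0 \<le> fps_nth (policy_fps q :: real fps) n"
  using policy_prod_bounds(1) by (simp add: policy_fps_def)

lemma F_mono:
  assumes "0 \<le> x" "x \<le> y" "ereal y < inverse (ereal (P_lim q))"
  shows "F q x \<le> F q y"
proof -
  let ?f = "policy_fps q :: real fps"
  have x: "ereal \<bar>x\<bar> < inverse (ereal (P_lim q))"
    using assms by (intro ereal_less_mono[OF assms(3)]) simp
  have y: "ereal \<bar>y\<bar> < inverse (ereal (P_lim q))"
    using assms by simp
  show ?thesis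
    unfolding F_eq_eval_fps[OF x] F_eq_eval_fps[OF y] eval_fps_def
    using assms x y policy_fps_nth_nonneg
    by (intro suminf_le summable_fps)
      (auto simp: policy_fps_conv_radius intro!: mult_left_mono power_mono)
qed

lemma F_nonneg:
  assumes "0 \<le> x" "ereal x < inverse (ereal (P_lim q))"
  shows "0 \<le> F q x"
proof -
  have "F q 0 = 0" by (simp add: F_def)
  then show ?thesis using F_mono[of 0 x] assms by simp
qed

lemma DERIV_F:
  assumes "ereal \<bar>x\<bar> < inverse (ereal (P_lim q))"
  shows "(F q has_real_derivative eval_fps (fps_deriv (policy_fps q)) x) (at x)"
proof -
  let ?S = "eball (0::real) (inverse (ereal (P_lim q)))"
  have "(eval_fps (policy_fps q) has_real_derivative eval_fps (fps_deriv (policy_fps q)) x) (at x)"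
    using assms by (intro has_field_derivative_eval_fps) (simp add: policy_fps_conv_radius)
  then show ?thesis
    by (rule has_field_derivative_transform_within_open[where S = ?S])
      (use assms in \<open>auto simp: F_eq_eval_fps\<close>)
qed

lemma DERIV_deriv_F:
  assumes "ereal \<bar>x\<bar> < inverse (ereal (P_lim q))"
  shows "\<exists>D. ((\<lambda>x. eval_fps (fps_deriv (policy_fps q)) x) has_real_derivative D) (at x)"
proof -
  have "ereal (norm x) < fps_conv_radius (fps_deriv (policy_fps q :: real fps))"
    using assms fps_conv_radius_deriv[of "policy_fps q :: real fps"]
    by (simp add: policy_fps_conv_radius)
  then show ?thesis by (blast intro: has_field_derivative_eval_fps)
qed

text \<open>
  The condition on \<open>\<gamma>\<close> in the definition of the thresholds says that \<open>x = lam / s\<close> lies in the part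
  \<open>(0, 1 / P)\<close> of the interval of convergence; \<open>1 / 0 = \<infinity>\<close> in the extended reals covers \<open>P = 0\<close>.
\<close>

lemma admissible_iff:
  assumes "s \<ge> 1"
  shows "gamma_P q s < ereal \<gamma> \<and> \<gamma> < sqrt (real s) \<longleftrightarrow>
    0 < 1 - \<gamma> / sqrt (real s) \<and> ereal (1 - \<gamma> / sqrt (real s)) < inverse (ereal (P_lim q))"
proof -
  have r: "sqrt (real s) > 0" using assms by simp
  show ?thesis
  proof (cases "P_lim q = 0")
    case True
    then show ?thesis using r by (simp add: gamma_P_def)
  next
    case False
    then have "P_lim q > 0" using P_lim_bounds by simp
    then show ?thesis using r by (auto simp: gamma_P_def field_simps)
  qed
qed

end

lemma inverse_erlang_B_sum:
  "lam > 0 \<Longrightarrow> inverse (erlang_B s lam) = (\<Sum>k=0..s. fact s / fact k * (1 / lam) ^ (s - k))"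
proof -
  assume lam: "lam > 0"
  have "inverse (erlang_B s lam) = (\<Sum>k=0..s. fact s / fact k * (lam ^ k / lam ^ s))"
    by (simp add: erlang_B_def field_simps sum_distrib_left sum_divide_distrib)
  also have "\<dots> = (\<Sum>k=0..s. fact s / fact k * (1 / lam) ^ (s - k))"
    using lam by (intro sum.cong refl) (simp add: power_diff power_one_over field_simps)
  finally show ?thesis .
qed

lemma inverse_erlang_B_ge_1: "lam > 0 \<Longrightarrow> inverse (erlang_B s lam) \<ge> 1"
proof -
  assume lam: "lam > 0"
  have "(\<Sum>k\<in>{s}. fact s / fact k * (1 / lam) ^ (s - k)) \<le> (\<Sum>k=0..s. fact s / fact k * (1 / lam) ^ (s - k))"
    using lam by (intro sum_mono2) auto
  then show ?thesis using inverse_erlang_B_sum[OF lam, of s] by simp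
qed

lemma inverse_erlang_B_strict_antimono:
  assumes "s \<ge> 1" "0 < lam" "lam < lam'"
  shows "inverse (erlang_B s lam') < inverse (erlang_B s lam)"
proof -
  have 1: "1 / lam' < 1 / lam" "0 \<le> 1 / lam'"
    using assms by (auto intro: divide_strict_left_mono)
  have "(\<Sum>k=0..s. fact s / fact k * (1 / lam') ^ (s - k)) < (\<Sum>k=0..s. fact s / fact k * (1 / lam) ^ (s - k))"
  proof (rule sum_strict_mono_ex1)
    show "\<forall>k\<in>{0..s}. fact s / fact k * (1 / lam') ^ (s - k) \<le> fact s / fact k * (1 / lam) ^ (s - k)"
      using 1 by (intro ballI mult_left_mono power_mono) auto
    have "(1 / lam') ^ s < (1 / lam) ^ s"
      using 1 assms by (intro power_strict_mono) auto
    then show "\<exists>k\<in>{0..s}. fact s / fact k * (1 / lam') ^ (s - k) < fact s / fact k * (1 / lam) ^ (s - k)"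
      by (intro bexI[of _ 0]) auto
  qed auto
  then show ?thesis using assms by (simp add: inverse_erlang_B_sum)
qed

lemma D_F_scaled:
  assumes "s \<ge> 1" "x = 1 - \<gamma> / sqrt (real s)" "x > 0"
  shows "D_F q s (real s - \<gamma> * sqrt (real s))
      = (1 + F q x) / (inverse (erlang_B s (real s * x)) + F q x)"
    and "D_FR q s (real s - \<gamma> * sqrt (real s))
      = (1 + (1 - 1 / x) * F q x) / (inverse (erlang_B s (real s * x)) + F q x)"
proof -
  have "real s - \<gamma> * sqrt (real s) = real s * x"
    using assms by (simp add: right_diff_distrib) (simp add: field_simps)
  then show "D_F q s (real s - \<gamma> * sqrt (real s))
      = (1 + F q x) / (inverse (erlang_B s (real s * x)) + F q x)"
    and "D_FR q s (real s - \<gamma> * sqrt (real s))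
      = (1 + (1 - 1 / x) * F q x) / (inverse (erlang_B s (real s * x)) + F q x)"
    using assms by (simp_all add: D_F_def D_FR_def)
qed

lemma blocking_ratio_strict_mono:
  fixes B1 B2 F1 F2 :: real
  assumes "1 \<le> B2" "B2 < B1" "0 \<le> F1" "F1 \<le> F2"
  shows "(1 + F1) / (B1 + F1) < (1 + F2) / (B2 + F2)"
proof -
  have "0 < (B1 - B2) * (1 + F2) + (F2 - F1) * (B2 - 1)"
    using assms by (intro add_pos_nonneg mult_pos_pos mult_nonneg_nonneg) auto
  then have "(1 + F1) * (B2 + F2) < (1 + F2) * (B1 + F1)"
    by (simp add: algebra_simps)
  then show ?thesis using assms by (simp add: divide_simps)
qed

text \<open>
  As \<open>\<gamma>\<close> grows, \<open>x\<close> decreases, so \<open>F\<close> decreases weakly and \<open>1 / erlang_B\<close> increases strictly; both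
  changes lower \<open>D_F\<close>. So any admissible solution is the one picked by the definite description.
\<close>

lemma gamma_sF_eqI:
  fixes q :: "nat \<Rightarrow> real"
  assumes q: "\<And>n. q n \<in> {0..1}" and s: "s \<ge> 1"
    and adm: "gamma_P q s < ereal \<gamma>" "\<gamma> < sqrt (real s)"
    and sol: "sqrt (real s) * D_F q s (real s - \<gamma> * sqrt (real s)) = \<epsilon>"
  shows "gamma_sF q s \<epsilon> = \<gamma>"
proof -
  have less: "D_F q s (real s - \<beta> * sqrt (real s)) < D_F q s (real s - \<alpha> * sqrt (real s))"
    if \<alpha>: "gamma_P q s < ereal \<alpha>" "\<alpha> < sqrt (real s)"
      and \<beta>: "gamma_P q s < ereal \<beta>" "\<beta> < sqrt (real s)" and "\<alpha> < \<beta>" for \<alpha> \<beta>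
  proof -
    define x y where "x = 1 - \<alpha> / sqrt (real s)" and "y = 1 - \<beta> / sqrt (real s)"
    have x: "x > 0" "ereal x < inverse (ereal (P_lim q))"
      using admissible_iff[OF q s, where \<gamma> = \<alpha>] \<alpha> by (auto simp: x_def)
    have y: "y > 0" "ereal y < inverse (ereal (P_lim q))"
      using admissible_iff[OF q s, where \<gamma> = \<beta>] \<beta> by (auto simp: y_def)
    have "y < x" using \<open>\<alpha> < \<beta>\<close> s by (simp add: x_def y_def divide_strict_right_mono)
    then show ?thesis
      unfolding D_F_scaled(1)[OF s x_def x(1)] D_F_scaled(1)[OF s y_def y(1)]
      using x y s
      by (intro blocking_ratio_strict_mono inverse_erlang_B_ge_1 inverse_erlang_B_strict_antimono
          F_nonneg F_mono q) auto
  qed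
  have r: "sqrt (real s) \<noteq> 0" using s by simp
  show ?thesis
    unfolding gamma_sF_def
  proof (rule the_equality)
    show "gamma_P q s < ereal \<gamma> \<and> \<gamma> < sqrt (real s) \<and>
           sqrt (real s) * D_F q s (real s - \<gamma> * sqrt (real s)) = \<epsilon>"
      using adm sol by simp
  next
    fix \<beta> assume \<beta>: "gamma_P q s < ereal \<beta> \<and> \<beta> < sqrt (real s) \<and>
           sqrt (real s) * D_F q s (real s - \<beta> * sqrt (real s)) = \<epsilon>"
    then have "D_F q s (real s - \<beta> * sqrt (real s)) = D_F q s (real s - \<gamma> * sqrt (real s))"
      using sol r by (metis mult_left_cancel)
    then show "\<beta> = \<gamma>"
      using less[of \<beta> \<gamma>] less[of \<gamma> \<beta>] \<beta> adm by (cases \<beta> \<gamma> rule: linorder_cases) auto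
  qed
qed

lemma of_real_islimpt_image:
  fixes x :: real
  assumes "x islimpt A"
  shows "(of_real x :: 'a::real_normed_field) islimpt of_real ` A"
  using assms unfolding islimpt_approachable
  by (metis dist_of_real imageI of_real_eq_iff)

text \<open>
  Multiplied by \<open>x ^ s\<close>, the equation \<open>D_FR = \<kappa>\<close> is an identity between functions that are analytic
  on the disc of convergence of \<open>F\<close>. If it held on an interval, it would hold at \<open>0\<close>, where
  everything vanishes except the lowest term \<open>\<kappa> * s! / s ^ s\<close> of the polynomial stemming from
  \<open>1 / erlang_B\<close>.
\<close>

lemma D_FR_not_locally_constant:
  fixes q :: "nat \<Rightarrow> real" and s :: nat
  assumes q: "\<And>n. q n \<in> {0..1}" and s: "s \<ge> 1" and \<kappa>: "\<kappa> \<noteq> 0"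
    and ab: "0 < a" "a < b" "ereal b < inverse (ereal (P_lim q))"
    and const: "\<And>x. a < x \<Longrightarrow> x < b \<Longrightarrow>
      1 + (1 - 1 / x) * F q x = \<kappa> * (inverse (erlang_B s (real s * x)) + F q x)"
  shows False
proof -
  define R where "R = inverse (ereal (P_lim q))"
  define f :: "complex \<Rightarrow> complex" where "f = eval_fps (policy_fps q)"
  define c where "c = (\<lambda>k. fact s / fact k * real s ^ k / real s ^ s)"
  \<comment> \<open>\<open>x ^ s\<close> times the difference of the two sides of \<open>const\<close>; no pole at \<open>0\<close> is left, as \<open>s \<ge> 1\<close>.\<close>
  define G where "G = (\<lambda>z::complex. z ^ s * (1 + f z) - z ^ (s - 1) * f z
      - of_real \<kappa> * ((\<Sum>k=0..s. of_real (c k) * z ^ k) + z ^ s * f z))"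
  have zero: "G (of_real x) = 0" if x: "a < x" "x < b" for x
  proof -
    have x0: "x > 0" using x ab by simp
    have "ereal \<bar>x\<bar> < R"
      unfolding R_def using x x0 by (intro ereal_less_mono[OF ab(3)]) simp
    then have fx: "f (of_real x) = of_real (F q x)"
      unfolding f_def R_def by (intro eval_policy_fps q)
    have B: "x ^ s * inverse (erlang_B s (real s * x)) = (\<Sum>k=0..s. c k * x ^ k)"
      unfolding erlang_B_def c_def sum_distrib_left using x0 s
      by (simp add: field_simps sum_distrib_left sum_divide_distrib power_mult_distrib)
    have xs: "x ^ s * (1 / x) = x ^ (s - 1)"
      using x0 s by (simp add: power_eq_if)
    have "x ^ s * (1 + F q x) - x ^ (s - 1) * F q x - \<kappa> * ((\<Sum>k=0..s. c k * x ^ k) + x ^ s * F q x)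
        = x ^ s * ((1 + (1 - 1 / x) * F q x) - \<kappa> * (inverse (erlang_B s (real s * x)) + F q x))"
      unfolding B[symmetric] xs[symmetric] by (simp only: algebra_simps)
    also have "\<dots> = 0" using const[OF x] by simp
    finally have "complex_of_real (x ^ s * (1 + F q x) - x ^ (s - 1) * F q x
        - \<kappa> * ((\<Sum>k=0..s. c k * x ^ k) + x ^ s * F q x)) = 0" by simp
    then show ?thesis by (simp add: G_def fx)
  qed
  have "G 0 = 0"
  proof (rule analytic_continuation[of G "eball 0 R" "of_real ` {a<..<b}" "of_real ((a + b) / 2)"])
    show "G holomorphic_on eball 0 R"
      unfolding G_def f_def
      by (intro holomorphic_intros) (simp_all add: policy_fps_conv_radius[OF q] R_def)
    show "of_real ` {a<..<b} \<subseteq> eball (0::complex) R"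
      using ab by (auto simp: R_def intro!: ereal_less_mono[OF ab(3)] simp del: inverse_ereal.simps)
    have "ereal \<bar>(a + b) / 2\<bar> < R"
      unfolding R_def using ab by (intro ereal_less_mono[OF ab(3)]) simp
    then show "complex_of_real ((a + b) / 2) \<in> eball 0 R"
      by (simp only: in_eball_iff dist_0_norm norm_of_real)
    show "complex_of_real ((a + b) / 2) islimpt of_real ` {a<..<b}"
      using ab by (intro of_real_islimpt_image islimpt_greaterThanLessThan1) auto
    have "R > 0" using ereal_less_mono[OF ab(3), of 0] ab by (simp add: R_def zero_ereal_def)
    then show "0 \<in> eball (0::complex) R" by (simp add: zero_ereal_def)
  qed (use zero in auto)
  moreover have "(\<Sum>k=0..s. of_real (c k) * (0::complex) ^ k) = of_real (c 0)"
    by (simp add: sum.atLeast_Suc_atMost)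
  moreover have "f 0 = 0" by (simp add: f_def eval_fps_at_0)
  ultimately have "complex_of_real (\<kappa> * c 0) = 0" using s by (simp add: G_def power_0_left)
  then have "\<kappa> * c 0 = 0" by (simp only: of_real_eq_0_iff)
  then show False using \<kappa> s by (simp add: c_def)
qed

text \<open>
  A weakly monotonic function that takes the same value at two points is constant between them.
\<close>

lemma gamma_sFR_eqI:
  fixes q :: "nat \<Rightarrow> real"
  assumes q: "\<And>n. q n \<in> {0..1}" and s: "s \<ge> 1" and \<epsilon>: "\<epsilon> \<noteq> 0"
    and mono: "D_FR_monotonic q s"
    and adm: "gamma_P q s < ereal \<gamma>" "\<gamma> < sqrt (real s)"
    and sol: "sqrt (real s) * D_FR q s (real s - \<gamma> * sqrt (real s)) = \<epsilon>"
  shows "gamma_sFR q s \<epsilon> = \<gamma>"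
proof -
  define r where "r = sqrt (real s)"
  have r: "r > 0" using s by (simp add: r_def)
  define D where "D = (\<lambda>\<gamma>. D_FR q s (real s - \<gamma> * r))"
  have unique: False
    if \<alpha>: "gamma_P q s < ereal \<alpha>" "\<alpha> < r" "r * D \<alpha> = \<epsilon>"
      and \<beta>: "gamma_P q s < ereal \<beta>" "\<beta> < r" "r * D \<beta> = \<epsilon>" and "\<alpha> < \<beta>" for \<alpha> \<beta>
  proof -
    have D: "D \<delta> = \<epsilon> / r" if \<delta>: "\<alpha> \<le> \<delta>" "\<delta> \<le> \<beta>" for \<delta>
    proof -
      let ?I = "{\<gamma>. gamma_P q s < ereal \<gamma> \<and> \<gamma> \<le> r}"
      have "gamma_P q s < ereal \<delta>" using \<alpha>(1) \<delta> by (meson ereal_less_eq(3) order_less_le_trans)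
      then have I: "\<alpha> \<in> ?I" "\<delta> \<in> ?I" "\<beta> \<in> ?I"
        using \<alpha> \<beta> \<delta> by auto
      have "mono_on ?I D \<or> antimono_on ?I D"
        using mono by (simp add: D_FR_monotonic_def D_def r_def Let_def)
      then have "(D \<alpha> \<le> D \<delta> \<and> D \<delta> \<le> D \<beta>) \<or> (D \<beta> \<le> D \<delta> \<and> D \<delta> \<le> D \<alpha>)"
        using I \<delta> by (meson monotone_onD)
      moreover have "D \<alpha> = \<epsilon> / r" "D \<beta> = \<epsilon> / r" using \<alpha> \<beta> r by (auto simp: field_simps)
      ultimately show ?thesis by auto
    qed
    define a b where "a = 1 - \<beta> / r" and "b = 1 - \<alpha> / r"
    show False
    proof (rule D_FR_not_locally_constant[OF q s, of "\<epsilon> / r" a b])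
      show "\<epsilon> / r \<noteq> 0" using \<epsilon> r by simp
      show "0 < a" using \<beta> r by (simp add: a_def)
      show "a < b" using \<open>\<alpha> < \<beta>\<close> r by (simp add: a_def b_def divide_strict_right_mono)
      show b: "ereal b < inverse (ereal (P_lim q))"
        using admissible_iff[OF q s, where \<gamma> = \<alpha>] \<alpha> by (simp add: b_def r_def)
      fix x assume x: "a < x" "x < b"
      define \<delta> where "\<delta> = r * (1 - x)"
      have x0: "x > 0" using x \<open>0 < a\<close> by simp
      have xR: "ereal x < inverse (ereal (P_lim q))"
        using x by (intro ereal_less_mono[OF b]) simp
      have "\<alpha> \<le> \<delta>" "\<delta> \<le> \<beta>" using x r by (auto simp: a_def b_def \<delta>_def field_simps)
      then have "D \<delta> = \<epsilon> / r" by (rule D)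
      moreover have "x = 1 - \<delta> / sqrt (real s)"
        using r by (simp add: \<delta>_def r_def)
      ultimately have "(1 + (1 - 1 / x) * F q x) / (inverse (erlang_B s (real s * x)) + F q x) = \<epsilon> / r"
        using D_F_scaled(2)[OF s, of x \<delta> q] x0 by (simp add: D_def r_def)
      moreover have "inverse (erlang_B s (real s * x)) + F q x > 0"
        using x0 s xR
        by (intro add_pos_nonneg F_nonneg q less_le_trans[OF zero_less_one inverse_erlang_B_ge_1]) auto
      ultimately show "1 + (1 - 1 / x) * F q x = \<epsilon> / r * (inverse (erlang_B s (real s * x)) + F q x)"
        by (metis less_irrefl nonzero_eq_divide_eq)
    qed
  qed
  show ?thesis
    unfolding gamma_sFR_def
  proof (rule the_equality)
    show "gamma_P q s < ereal \<gamma> \<and> \<gamma> < sqrt (real s) \<and>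
           sqrt (real s) * D_FR q s (real s - \<gamma> * sqrt (real s)) = \<epsilon>"
      using adm sol by simp
  next
    fix \<beta> assume \<beta>: "gamma_P q s < ereal \<beta> \<and> \<beta> < sqrt (real s) \<and>
           sqrt (real s) * D_FR q s (real s - \<beta> * sqrt (real s)) = \<epsilon>"
    then show "\<beta> = \<gamma>"
      using unique[of \<beta> \<gamma>] unique[of \<gamma> \<beta>] adm sol unfolding D_def r_def
      by (cases \<beta> \<gamma> rule: linorder_cases) auto
  qed
qed

section \<open>Perturbed roots of the scaled equation\<close>

lemma DERIV_imp_local_lipschitz:
  fixes f :: "real \<Rightarrow> real"
  assumes "(f has_real_derivative d) (at a)"
  obtains r where "r > 0" "\<And>x. \<bar>x - a\<bar> < r \<Longrightarrow> \<bar>f x - f a\<bar> \<le> (\<bar>d\<bar> + 1) * \<bar>x - a\<bar>"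
proof -
  have "\<forall>\<^sub>F x in at a. dist ((f x - f a) / (x - a)) d < 1"
    using assms by (intro tendstoD) (simp_all add: has_field_derivative_iff)
  then obtain r where r: "r > 0" "\<And>x. x \<noteq> a \<Longrightarrow> dist x a < r \<Longrightarrow> dist ((f x - f a) / (x - a)) d < 1"
    unfolding eventually_at by blast
  have "\<bar>f x - f a\<bar> \<le> (\<bar>d\<bar> + 1) * \<bar>x - a\<bar>" if "\<bar>x - a\<bar> < r" for x
  proof (cases "x = a")
    case False
    then have "\<bar>(f x - f a) / (x - a)\<bar> \<le> \<bar>d\<bar> + 1"
      using r(2)[of x] that False unfolding dist_real_def by linarith
    then show ?thesis using False by (simp add: abs_divide divide_simps)
  qed simp
  then show ?thesis using r that by blast
qed

text \<open>
  The mean value inequality for \<open>f x - f' a * x\<close>, whose derivative is Lipschitz at \<open>a\<close>.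
\<close>

lemma DERIV_imp_quadratic_remainder:
  fixes f f' :: "real \<Rightarrow> real"
  assumes "\<rho> > 0" and f: "\<And>x. \<bar>x - a\<bar> < \<rho> \<Longrightarrow> (f has_real_derivative f' x) (at x)"
    and f': "(f' has_real_derivative d) (at a)"
  obtains r where "r > 0"
    "\<And>x. \<bar>x - a\<bar> < r \<Longrightarrow> \<bar>f x - f a - f' a * (x - a)\<bar> \<le> (\<bar>d\<bar> + 1) * (x - a)\<^sup>2"
proof -
  obtain r where r: "r > 0" "\<And>x. \<bar>x - a\<bar> < r \<Longrightarrow> \<bar>f' x - f' a\<bar> \<le> (\<bar>d\<bar> + 1) * \<bar>x - a\<bar>"
    using DERIV_imp_local_lipschitz[OF f'] by blast
  have "\<bar>f x - f a - f' a * (x - a)\<bar> \<le> (\<bar>d\<bar> + 1) * (x - a)\<^sup>2" if x: "\<bar>x - a\<bar> < min r \<rho>" for x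
  proof -
    let ?S = "cball a \<bar>x - a\<bar>"
    have "norm ((f x - f' a * x) - (f a - f' a * a)) \<le> ((\<bar>d\<bar> + 1) * \<bar>x - a\<bar>) * norm (x - a)"
    proof (rule field_differentiable_bound[where S = ?S and f' = "\<lambda>x. f' x - f' a"])
      fix z assume "z \<in> ?S"
      then have z: "\<bar>z - a\<bar> \<le> \<bar>x - a\<bar>" by (simp add: dist_real_def abs_minus_commute)
      show "((\<lambda>x. f x - f' a * x) has_field_derivative f' z - f' a) (at z within ?S)"
        using z x by (auto intro!: derivative_eq_intros has_field_derivative_at_within[OF f])
      have "(\<bar>d\<bar> + 1) * \<bar>z - a\<bar> \<le> (\<bar>d\<bar> + 1) * \<bar>x - a\<bar>"
        using z by (intro mult_left_mono) auto
      then show "norm (f' z - f' a) \<le> (\<bar>d\<bar> + 1) * \<bar>x - a\<bar>"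
        using r(2)[of z] z x by simp
    qed (auto simp: dist_real_def)
    then show ?thesis by (simp add: algebra_simps power2_eq_square abs_if split: if_splits)
  qed
  then show ?thesis using that[of "min r \<rho>"] r \<open>\<rho> > 0\<close> by simp
qed

text \<open>
  One Newton step for \<open>M c + \<delta> H c = M a\<close>. As \<open>M'\<close> is bounded below, the equation first gives
  \<open>c - a = O(\<delta>)\<close>; this crude bound makes the Taylor remainders of \<open>M\<close> and \<open>\<delta> H\<close> at \<open>a\<close> of size \<open>O(\<delta>\<^sup>2)\<close>,
  and the equation, solved for the linear term, gives the first-order correction. The constants depend
  on \<open>C\<close> but not on \<open>c\<close> and \<open>\<delta>\<close>.
\<close>

lemma perturbed_root:
  fixes M M' H :: "real \<Rightarrow> real"
  assumes M: "\<And>x. x \<in> {a - 1..a + 1} \<Longrightarrow> (M has_real_derivative M' x) (at x)"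
    and M'_cont: "continuous_on {a - 1..a + 1} M'"
    and M'_pos: "\<And>x. x \<in> {a - 1..a + 1} \<Longrightarrow> M' x > 0"
    and M'_deriv: "(M' has_real_derivative d) (at a)"
    and H_cont: "continuous_on {a - 1..a + 1} H"
    and H_deriv: "(H has_real_derivative e) (at a)"
  obtains K \<delta>0 where "\<delta>0 > 0"
    "\<And>\<delta> c. 0 < \<delta> \<Longrightarrow> \<delta> \<le> \<delta>0 \<Longrightarrow> c \<in> {a - 1..a + 1} \<Longrightarrow>
      \<bar>M c - M a + \<delta> * H c\<bar> \<le> C * \<delta>\<^sup>2 \<Longrightarrow> \<bar>c - (a - \<delta> * (H a / M' a))\<bar> \<le> K * \<delta>\<^sup>2"
proof -
  let ?I = "{a - 1..a + 1}"
  \<comment> \<open>Local constants at \<open>a\<close>, then global ones on the interval; \<open>k\<close> is the constant of the crude bound.\<close>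
  obtain r1 where r1: "r1 > 0"
    "\<And>x. \<bar>x - a\<bar> < r1 \<Longrightarrow> \<bar>M x - M a - M' a * (x - a)\<bar> \<le> (\<bar>d\<bar> + 1) * (x - a)\<^sup>2"
    by (rule DERIV_imp_quadratic_remainder[of 1 a M M', OF _ M M'_deriv]) (auto simp: abs_if split: if_splits)
  obtain r2 where r2: "r2 > 0" "\<And>x. \<bar>x - a\<bar> < r2 \<Longrightarrow> \<bar>H x - H a\<bar> \<le> (\<bar>e\<bar> + 1) * \<bar>x - a\<bar>"
    using DERIV_imp_local_lipschitz[OF H_deriv] by blast
  obtain x0 where "x0 \<in> ?I" "\<And>x. x \<in> ?I \<Longrightarrow> M' x0 \<le> M' x"
    using continuous_attains_inf[OF _ _ M'_cont] by auto
  then obtain m where m: "m > 0" "\<And>x. x \<in> ?I \<Longrightarrow> m \<le> M' x" using M'_pos by blast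
  have "compact (H ` ?I)" by (intro compact_continuous_image H_cont) auto
  then obtain h where h: "h > 0" "\<And>x. x \<in> ?I \<Longrightarrow> \<bar>H x\<bar> \<le> h"
    using compact_imp_bounded bounded_pos by (metis imageI real_norm_def)
  define k where "k = (h + \<bar>C\<bar>) / m"
  have k: "k > 0" using h m by (simp add: k_def add_pos_nonneg)
  define \<delta>0 where "\<delta>0 = min 1 (min r1 r2 / (2 * k))"
  define K where "K = (\<bar>C\<bar> + (\<bar>d\<bar> + 1) * k\<^sup>2 + (\<bar>e\<bar> + 1) * k) / M' a"
  have Ma: "M' a > 0" by (rule M'_pos) simp
  have "\<bar>c - (a - \<delta> * (H a / M' a))\<bar> \<le> K * \<delta>\<^sup>2"
    if \<delta>: "0 < \<delta>" "\<delta> \<le> \<delta>0" and c: "c \<in> ?I" and E: "\<bar>M c - M a + \<delta> * H c\<bar> \<le> C * \<delta>\<^sup>2" for \<delta> c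
  proof -
    have d1: "\<delta> \<le> 1" "\<delta> * k < min r1 r2"
    proof -
      show "\<delta> \<le> 1" using \<delta> by (simp add: \<delta>0_def)
      have "\<delta> * (2 * k) \<le> min r1 r2"
        using \<delta> k by (simp add: \<delta>0_def pos_le_divide_eq)
      moreover have "\<delta> * (2 * k) = \<delta> * k + \<delta> * k" "\<delta> * k > 0" using \<delta> k by auto
      ultimately show "\<delta> * k < min r1 r2" by linarith
    qed
    have C: "C * \<delta>\<^sup>2 \<le> \<bar>C\<bar> * \<delta>\<^sup>2" by (intro mult_right_mono) auto
    have "\<exists>z\<in>?I. M c - M a = (c - a) * M' z"
    proof (cases c a rule: linorder_cases)
      case less
      then obtain z where "c < z" "z < a" "M a - M c = (a - c) * M' z"
        using MVT2[of c a M M'] M c by auto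
      then show ?thesis using c by (intro bexI[of _ z]) (auto simp: algebra_simps)
    next
      case greater
      then obtain z where "a < z" "z < c" "M c - M a = (c - a) * M' z"
        using MVT2[of a c M M'] M c by auto
      then show ?thesis using c by (intro bexI[of _ z]) auto
    qed (auto intro: bexI[of _ a])
    then obtain z where z: "z \<in> ?I" "M c - M a = (c - a) * M' z" by blast
    have "\<bar>c - a\<bar> * m \<le> \<bar>c - a\<bar> * M' z" using m(2)[OF z(1)] by (intro mult_left_mono) auto
    also have "\<dots> = \<bar>M c - M a\<bar>" using M'_pos[OF z(1)] by (simp add: z(2) abs_mult)
    also have "\<dots> \<le> \<bar>C\<bar> * \<delta>\<^sup>2 + \<bar>\<delta> * H c\<bar>" using E C by linarith
    also have "\<dots> \<le> \<bar>C\<bar> * \<delta> + \<delta> * h"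
    proof -
      have "\<delta>\<^sup>2 \<le> \<delta>" using \<delta> d1 by (simp add: power2_eq_square mult_left_le)
      then have "\<bar>C\<bar> * \<delta>\<^sup>2 \<le> \<bar>C\<bar> * \<delta>" by (intro mult_left_mono) auto
      moreover have "\<bar>\<delta> * H c\<bar> \<le> \<delta> * h" using h(2)[OF c] \<delta> by (simp add: abs_mult)
      ultimately show ?thesis by linarith
    qed
    finally have ca: "\<bar>c - a\<bar> \<le> \<delta> * k" using m(1) by (simp add: k_def field_simps)
    have "\<bar>M c - M a - M' a * (c - a)\<bar> \<le> (\<bar>d\<bar> + 1) * (c - a)\<^sup>2"
      using ca d1 by (intro r1(2)) simp
    also have "\<dots> \<le> (\<bar>d\<bar> + 1) * (\<delta> * k)\<^sup>2"
      using ca by (intro mult_left_mono) (metis abs_ge_zero power2_abs power_mono, simp)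
    finally have 1: "\<bar>M c - M a - M' a * (c - a)\<bar> \<le> (\<bar>d\<bar> + 1) * k\<^sup>2 * \<delta>\<^sup>2"
      by (simp add: power_mult_distrib mult_ac)
    have "\<bar>H c - H a\<bar> \<le> (\<bar>e\<bar> + 1) * \<bar>c - a\<bar>"
      using ca d1 by (intro r2(2)) simp
    also have "\<dots> \<le> (\<bar>e\<bar> + 1) * (\<delta> * k)" using ca by (intro mult_left_mono) auto
    finally have "\<delta> * \<bar>H c - H a\<bar> \<le> \<delta> * ((\<bar>e\<bar> + 1) * (\<delta> * k))"
      using \<delta> by (intro mult_left_mono) auto
    then have 2: "\<bar>\<delta> * (H c - H a)\<bar> \<le> (\<bar>e\<bar> + 1) * k * \<delta>\<^sup>2"
      using \<delta> by (simp add: abs_mult power2_eq_square mult_ac)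
    have "M' a * (c - a) + \<delta> * H a
        = (M c - M a + \<delta> * H c) - (M c - M a - M' a * (c - a)) - \<delta> * (H c - H a)"
      by (simp add: algebra_simps)
    then have "\<bar>M' a * (c - a) + \<delta> * H a\<bar> \<le> \<bar>C\<bar> * \<delta>\<^sup>2 + (\<bar>d\<bar> + 1) * k\<^sup>2 * \<delta>\<^sup>2 + (\<bar>e\<bar> + 1) * k * \<delta>\<^sup>2"
      using 1 2 E C by linarith
    also have "\<dots> = K * \<delta>\<^sup>2 * M' a" using Ma by (simp add: K_def field_simps)
    also have "M' a * (c - a) + \<delta> * H a = (c - (a - \<delta> * (H a / M' a))) * M' a"
      using Ma by (simp add: field_simps)
    finally show ?thesis using Ma by (simp add: abs_mult)
  qed
  moreover have "\<delta>0 > 0" using r1 r2 k by (simp add: \<delta>0_def)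
  ultimately show ?thesis using that by blast
qed

text \<open>
  The equation \<open>I = r Y(x) - F(x)\<close>, divided by \<open>r\<close> and expanded with \<open>x - 1 = - \<gamma> / r\<close>. The function \<open>Y\<close>
  is needed to second order, but \<open>F\<close>, which carries a factor \<open>1 / r\<close>, only to first order.
\<close>

lemma scaled_equation_expansion:
  fixes Y Y' F :: "real \<Rightarrow> real" and b \<rho> :: real
  assumes \<rho>: "\<rho> > 0"
    and Y: "\<And>x. \<bar>x - 1\<bar> < \<rho> \<Longrightarrow> (Y has_real_derivative Y' x) (at x)"
    and Y': "(Y' has_real_derivative d) (at 1)"
    and F: "(F has_real_derivative e) (at 1)"
    and b: "b \<ge> 0"
  shows "\<exists>C. \<forall>\<^sub>F s in sequentially. \<forall>\<gamma>. \<bar>\<gamma>\<bar> \<le> b \<longrightarrow>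
    \<bar>inverse (erlang_B s (real s * (1 - \<gamma> / sqrt (real s)))) / sqrt (real s)
       - Y (1 - \<gamma> / sqrt (real s)) + F (1 - \<gamma> / sqrt (real s)) / sqrt (real s)
       - (mills \<gamma> - Y 1 + 1 / sqrt (real s) * (erlang_corr \<gamma> + F 1 + Y' 1 * \<gamma>))\<bar>
     \<le> C * (1 / sqrt (real s))\<^sup>2"
proof -
  obtain C1 s0 where C1: "\<And>s x. s \<ge> s0 \<Longrightarrow> \<bar>x\<bar> \<le> b \<Longrightarrow>
    \<bar>inverse (erlang_B s (real s - x * sqrt (real s)))
       - (sqrt (real s) * mills x + erlang_corr x)\<bar> \<le> C1 / sqrt (real s)"
    using erlang_B_expansion[OF b] by blast
  obtain r1 where r1: "r1 > 0"
    "\<And>x. \<bar>x - 1\<bar> < r1 \<Longrightarrow> \<bar>Y x - Y 1 - Y' 1 * (x - 1)\<bar> \<le> (\<bar>d\<bar> + 1) * (x - 1)\<^sup>2"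
    using DERIV_imp_quadratic_remainder[OF \<rho> Y Y'] by blast
  obtain r2 where r2: "r2 > 0" "\<And>x. \<bar>x - 1\<bar> < r2 \<Longrightarrow> \<bar>F x - F 1\<bar> \<le> (\<bar>e\<bar> + 1) * \<bar>x - 1\<bar>"
    using DERIV_imp_local_lipschitz[OF F] by blast
  define C where "C = C1 + (\<bar>d\<bar> + 1) * b\<^sup>2 + (\<bar>e\<bar> + 1) * b"
  have lim: "((\<lambda>s. b / sqrt (real s)) \<longlongrightarrow> 0) sequentially"
    by real_asymp
  have "\<forall>\<^sub>F s in sequentially. b / sqrt (real s) < min r1 r2"
    using order_tendstoD(2)[OF lim, of "min r1 r2"] r1 r2 by simp
  then have "\<forall>\<^sub>F s in sequentially. \<forall>\<gamma>. \<bar>\<gamma>\<bar> \<le> b \<longrightarrow>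
    \<bar>inverse (erlang_B s (real s * (1 - \<gamma> / sqrt (real s)))) / sqrt (real s)
       - Y (1 - \<gamma> / sqrt (real s)) + F (1 - \<gamma> / sqrt (real s)) / sqrt (real s)
       - (mills \<gamma> - Y 1 + 1 / sqrt (real s) * (erlang_corr \<gamma> + F 1 + Y' 1 * \<gamma>))\<bar>
     \<le> C * (1 / sqrt (real s))\<^sup>2"
    using eventually_ge_at_top[of s0] eventually_ge_at_top[of 1]
  proof (eventually_elim, intro allI impI)
    fix s :: nat and \<gamma> :: real
    assume small: "b / sqrt (real s) < min r1 r2" and s: "s0 \<le> s" "1 \<le> s" and \<gamma>: "\<bar>\<gamma>\<bar> \<le> b"
    define \<delta> where "\<delta> = 1 / sqrt (real s)"
    define x where "x = 1 - \<gamma> / sqrt (real s)"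
    define I where "I = inverse (erlang_B s (real s * x))"
    have r: "sqrt (real s) > 0" using s by simp
    then have \<delta>: "\<delta> > 0" "sqrt (real s) * \<delta> = 1" by (auto simp: \<delta>_def)
    have sx: "real s * x = real s - \<gamma> * sqrt (real s)"
      using s by (simp add: x_def right_diff_distrib) (simp add: field_simps)
    have x1: "x - 1 = - (\<delta> * \<gamma>)" by (simp add: x_def \<delta>_def)
    have x1b: "\<bar>x - 1\<bar> \<le> \<delta> * b" using \<gamma> \<delta> by (simp add: x1 abs_mult)
    moreover have "\<delta> * b < min r1 r2" using small by (simp add: \<delta>_def)
    ultimately have xr: "\<bar>x - 1\<bar> < r1" "\<bar>x - 1\<bar> < r2" by auto
    have "\<bar>I - (sqrt (real s) * mills \<gamma> + erlang_corr \<gamma>)\<bar> \<le> C1 * \<delta>"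
      using C1[OF s(1) \<gamma>] by (simp add: I_def sx \<delta>_def)
    then have "\<delta> * \<bar>I - (sqrt (real s) * mills \<gamma> + erlang_corr \<gamma>)\<bar> \<le> \<delta> * (C1 * \<delta>)"
      using \<delta> by (intro mult_left_mono) auto
    also have "\<delta> * \<bar>I - (sqrt (real s) * mills \<gamma> + erlang_corr \<gamma>)\<bar>
        = \<bar>\<delta> * (I - (sqrt (real s) * mills \<gamma> + erlang_corr \<gamma>))\<bar>"
      using \<delta>(1) by (simp add: abs_mult)
    also have "\<delta> * (I - (sqrt (real s) * mills \<gamma> + erlang_corr \<gamma>))
        = \<delta> * I - (sqrt (real s) * \<delta>) * mills \<gamma> - \<delta> * erlang_corr \<gamma>"
      by (simp add: algebra_simps)
    finally have 1: "\<bar>\<delta> * I - mills \<gamma> - \<delta> * erlang_corr \<gamma>\<bar> \<le> C1 * \<delta>\<^sup>2"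
      unfolding \<delta>(2) by (simp add: power2_eq_square mult_ac)
    have "\<bar>Y x - Y 1 - Y' 1 * (x - 1)\<bar> \<le> (\<bar>d\<bar> + 1) * (x - 1)\<^sup>2" by (rule r1(2)[OF xr(1)])
    also have "\<dots> \<le> (\<bar>d\<bar> + 1) * (\<delta> * b)\<^sup>2"
      using x1b by (intro mult_left_mono) (metis abs_ge_zero power2_abs power_mono, simp)
    finally have 2: "\<bar>Y x - Y 1 + \<delta> * (Y' 1 * \<gamma>)\<bar> \<le> (\<bar>d\<bar> + 1) * b\<^sup>2 * \<delta>\<^sup>2"
      by (simp add: x1 power_mult_distrib mult_ac)
    have "\<bar>F x - F 1\<bar> \<le> (\<bar>e\<bar> + 1) * \<bar>x - 1\<bar>" by (rule r2(2)[OF xr(2)])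
    also have "\<dots> \<le> (\<bar>e\<bar> + 1) * (\<delta> * b)" using x1b by (intro mult_left_mono) auto
    finally have "\<delta> * \<bar>F x - F 1\<bar> \<le> \<delta> * ((\<bar>e\<bar> + 1) * (\<delta> * b))"
      using \<delta> by (intro mult_left_mono) auto
    then have 3: "\<bar>\<delta> * F x - \<delta> * F 1\<bar> \<le> (\<bar>e\<bar> + 1) * b * \<delta>\<^sup>2"
      using \<delta>(1) by (simp add: power2_eq_square mult_ac abs_mult flip: right_diff_distrib)
    have "C * \<delta>\<^sup>2 = C1 * \<delta>\<^sup>2 + (\<bar>d\<bar> + 1) * b\<^sup>2 * \<delta>\<^sup>2 + (\<bar>e\<bar> + 1) * b * \<delta>\<^sup>2"
      by (simp add: C_def algebra_simps)
    moreover have "\<delta> * (erlang_corr \<gamma> + F 1 + Y' 1 * \<gamma>) = \<delta> * erlang_corr \<gamma> + \<delta> * F 1 + \<delta> * (Y' 1 * \<gamma>)"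
      by (simp add: algebra_simps)
    ultimately have "\<bar>\<delta> * I - Y x + \<delta> * F x
       - (mills \<gamma> - Y 1 + \<delta> * (erlang_corr \<gamma> + F 1 + Y' 1 * \<gamma>))\<bar> \<le> C * \<delta>\<^sup>2"
      using 1 2 3 by linarith
    then show "\<bar>inverse (erlang_B s (real s * (1 - \<gamma> / sqrt (real s)))) / sqrt (real s)
       - Y (1 - \<gamma> / sqrt (real s)) + F (1 - \<gamma> / sqrt (real s)) / sqrt (real s)
       - (mills \<gamma> - Y 1 + 1 / sqrt (real s) * (erlang_corr \<gamma> + F 1 + Y' 1 * \<gamma>))\<bar>
     \<le> C * (1 / sqrt (real s))\<^sup>2"
      unfolding x_def[symmetric] I_def[symmetric] by (simp add: \<delta>_def)
  qed
  then show ?thesis by blast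
qed

lemma continuous_on_inverse_erlang_B:
  assumes "s \<ge> 1"
  shows "continuous_on {0<..} (\<lambda>x. inverse (erlang_B s (real s * x)))"
proof -
  have "continuous_on {0<..} (\<lambda>x. \<Sum>k=0..s. fact s / fact k * (1 / (real s * x)) ^ (s - k))"
    using assms by (intro continuous_intros) auto
  then show ?thesis
    using assms by (subst continuous_on_cong[OF refl inverse_erlang_B_sum]) auto
qed

text \<open>
  Existence and expansion of the solution for both thresholds at once. The hypothesis on \<open>sol\<close>
  expresses uniqueness: whatever solves the equation near \<open>x = 1\<close> must be \<open>sol s\<close>. The size of the scaled
  equation at \<open>a - 1\<close> and \<open>a + 1\<close> is governed by \<open>M(a - 1) < M(a) < M(a + 1)\<close>, which gives the sign change.
\<close>

lemma root_expansion:
  fixes Y Y' F F' :: "real \<Rightarrow> real" and a \<rho> :: real and sol :: "nat \<Rightarrow> real"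
  assumes \<rho>: "\<rho> > 0" "\<rho> \<le> 1"
    and Y: "\<And>x. \<bar>x - 1\<bar> < \<rho> \<Longrightarrow> (Y has_real_derivative Y' x) (at x)"
    and Y': "(Y' has_real_derivative d) (at 1)"
    and F: "\<And>x. \<bar>x - 1\<bar> < \<rho> \<Longrightarrow> (F has_real_derivative F' x) (at x)"
    and a: "mills a = Y 1"
    and sol: "\<And>s \<gamma> x. s \<ge> 1 \<Longrightarrow> x = 1 - \<gamma> / sqrt (real s) \<Longrightarrow> \<bar>x - 1\<bar> < \<rho> \<Longrightarrow>
      inverse (erlang_B s (real s * x)) = sqrt (real s) * Y x - F x \<Longrightarrow> sol s = \<gamma>"
  shows "(\<lambda>s. sol s - (a - 1 / sqrt (real s) * ((erlang_corr a + F 1 + Y' 1 * a) / (1 + a * mills a))))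
    \<in> O(\<lambda>s. 1 / real s)"
proof -
  define H where "H = (\<lambda>\<gamma>. erlang_corr \<gamma> + F 1 + Y' 1 * \<gamma>)"
  define \<Psi> where "\<Psi> = (\<lambda>s \<gamma>. inverse (erlang_B s (real s * (1 - \<gamma> / sqrt (real s)))) / sqrt (real s)
       - Y (1 - \<gamma> / sqrt (real s)) + F (1 - \<gamma> / sqrt (real s)) / sqrt (real s))"
  define b where "b = \<bar>a\<bar> + 1"
  have b: "b \<ge> 0" by (simp add: b_def)
  obtain C where C: "\<forall>\<^sub>F s in sequentially. \<forall>\<gamma>. \<bar>\<gamma>\<bar> \<le> b \<longrightarrow>
      \<bar>\<Psi> s \<gamma> - (mills \<gamma> - mills a + 1 / sqrt (real s) * H \<gamma>)\<bar> \<le> C * (1 / sqrt (real s))\<^sup>2"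
    using scaled_equation_expansion[OF \<rho>(1) Y Y' F b] \<rho>(1) unfolding \<Psi>_def H_def a by auto
  have H_deriv: "(H has_real_derivative (\<gamma>\<^sup>2 * mills \<gamma> + \<gamma> * erlang_corr \<gamma>) + Y' 1) (at \<gamma>)" for \<gamma>
    unfolding H_def by (auto intro!: derivative_eq_intros)
  have H_cont: "continuous_on A H" for A
    by (rule DERIV_continuous_on[OF has_field_derivative_at_within[OF H_deriv]])
  obtain K \<delta>0 where K: "\<delta>0 > 0"
    "\<And>\<delta> c. 0 < \<delta> \<Longrightarrow> \<delta> \<le> \<delta>0 \<Longrightarrow> c \<in> {a - 1..a + 1} \<Longrightarrow>
      \<bar>mills c - mills a + \<delta> * H c\<bar> \<le> C * \<delta>\<^sup>2 \<Longrightarrow> \<bar>c - (a - \<delta> * (H a / (1 + a * mills a)))\<bar> \<le> K * \<delta>\<^sup>2"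
  proof (rule perturbed_root[of a mills "\<lambda>x. 1 + x * mills x" _ H])
    show "(mills has_real_derivative 1 + x * mills x) (at x)" for x
      using DERIV_mills[OF DERIV_ident, of x] by simp
    show "continuous_on {a - 1..a + 1} (\<lambda>x. 1 + x * mills x)"
      by (intro continuous_intros)
    show "((\<lambda>x. 1 + x * mills x) has_real_derivative (a * (1 + a * mills a) + mills a)) (at a)"
      by (auto intro!: derivative_eq_intros)
    show "(H has_real_derivative (a\<^sup>2 * mills a + a * erlang_corr a) + Y' 1) (at a)"
      by (rule H_deriv)
  qed (use mills_deriv_pos H_cont in auto)
  have lim: "((\<lambda>s. c / sqrt (real s)) \<longlongrightarrow> 0) sequentially" for c
    by real_asymp
  define \<mu> where "\<mu> = min (mills (a + 1) - mills a) (mills a - mills (a - 1))"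
  have \<mu>: "\<mu> > 0" using strict_mono_less[OF mills_strict_mono] by (simp add: \<mu>_def)
  define h where "h = max \<bar>H (a + 1)\<bar> \<bar>H (a - 1)\<bar> + \<bar>C\<bar>"
  have "\<forall>\<^sub>F s in sequentially. 1 / sqrt (real s) < \<delta>0"
    using order_tendstoD(2)[OF lim K(1)] .
  moreover have "\<forall>\<^sub>F s in sequentially. h / sqrt (real s) < \<mu>"
    using order_tendstoD(2)[OF lim \<mu>] .
  moreover have "\<forall>\<^sub>F s in sequentially. b / sqrt (real s) < \<rho>"
    using order_tendstoD(2)[OF lim \<rho>(1)] .
  ultimately have "\<forall>\<^sub>F s in sequentially.
     norm (sol s - (a - 1 / sqrt (real s) * (H a / (1 + a * mills a)))) \<le> K * norm (1 / real s)"
    using eventually_ge_at_top[of 1] C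
  proof eventually_elim
    case (elim s)
    define \<delta> where "\<delta> = 1 / sqrt (real s)"
    have r: "sqrt (real s) \<ge> 1" using elim by simp
    then have \<delta>: "0 < \<delta>" "\<delta> \<le> \<delta>0" "\<delta> \<le> 1" "\<delta>\<^sup>2 = 1 / real s"
      using elim by (auto simp: \<delta>_def power_divide)
    have xr: "\<bar>(1 - \<gamma> / sqrt (real s)) - 1\<bar> < \<rho>" if "\<gamma> \<in> {a - 1..a + 1}" for \<gamma>
    proof -
      have "\<bar>\<gamma>\<bar> \<le> b" using that by (auto simp: b_def)
      then have "\<bar>\<gamma>\<bar> / sqrt (real s) \<le> b / sqrt (real s)" by (intro divide_right_mono) auto
      then show ?thesis using elim by simp
    qed
    have est: "\<bar>\<Psi> s \<gamma> - (mills \<gamma> - mills a + \<delta> * H \<gamma>)\<bar> \<le> C * \<delta>\<^sup>2" if "\<gamma> \<in> {a - 1..a + 1}" for \<gamma>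
      using elim that unfolding \<delta>_def b_def by auto
    have small: "\<bar>\<Psi> s \<gamma> - (mills \<gamma> - mills a)\<bar> < \<mu>" if \<gamma>: "\<gamma> = a + 1 \<or> \<gamma> = a - 1" for \<gamma>
    proof -
      have "\<delta> * \<delta> \<le> \<delta> * 1" using \<delta> by (intro mult_left_mono) auto
      then have "C * \<delta>\<^sup>2 \<le> \<bar>C\<bar> * \<delta>" unfolding power2_eq_square using \<delta> by (intro mult_mono) auto
      moreover have "\<bar>\<delta> * H \<gamma>\<bar> \<le> \<delta> * max \<bar>H (a + 1)\<bar> \<bar>H (a - 1)\<bar>"
        using \<gamma> \<delta> by (auto simp: abs_mult intro!: mult_left_mono)
      ultimately
      have "\<bar>\<Psi> s \<gamma> - (mills \<gamma> - mills a)\<bar> \<le> \<bar>C\<bar> * \<delta> + \<delta> * max \<bar>H (a + 1)\<bar> \<bar>H (a - 1)\<bar>"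
      proof -
        have "\<gamma> \<in> {a - 1..a + 1}" using \<gamma> by auto
        from est[OF this] show ?thesis
          using \<open>C * \<delta>\<^sup>2 \<le> \<bar>C\<bar> * \<delta>\<close> \<open>\<bar>\<delta> * H \<gamma>\<bar> \<le> \<delta> * max \<bar>H (a + 1)\<bar> \<bar>H (a - 1)\<bar>\<close>
          by linarith
      qed
      also have "\<dots> = h / sqrt (real s)" by (simp add: h_def \<delta>_def add_divide_distrib)
      finally show ?thesis using elim by simp
    qed
    have cont: "continuous_on {a - 1..a + 1} (\<Psi> s)"
    proof -
      let ?x = "\<lambda>\<gamma>. 1 - \<gamma> / sqrt (real s)"
      let ?B = "ball 1 \<rho> :: real set"
      have sub: "?x ` {a - 1..a + 1} \<subseteq> ?B"
        using xr by (auto simp: dist_real_def)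
      have x: "continuous_on {a - 1..a + 1} ?x" using r by (intro continuous_intros) auto
      have YF: "continuous_on ?B Y" "continuous_on ?B F"
        by (rule DERIV_continuous_on, rule has_field_derivative_at_within, rule Y F,
            simp add: dist_real_def abs_minus_commute)+
      have B: "continuous_on ?B (\<lambda>x. inverse (erlang_B s (real s * x)))"
        by (rule continuous_on_subset[OF continuous_on_inverse_erlang_B])
          (use elim \<rho> in \<open>auto simp: dist_real_def\<close>)
      show ?thesis
        unfolding \<Psi>_def using r
        by (intro continuous_on_add continuous_on_diff continuous_on_divide continuous_on_const
            continuous_on_compose2[OF YF(1) x sub] continuous_on_compose2[OF YF(2) x sub]
            continuous_on_compose2[OF B x sub]) auto
    qed
    have "\<Psi> s (a - 1) \<le> 0" "0 \<le> \<Psi> s (a + 1)"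
      using small[of "a - 1"] small[of "a + 1"] unfolding \<mu>_def by auto
    then have "\<exists>c\<ge>a - 1. c \<le> a + 1 \<and> \<Psi> s c = 0"
      by (intro IVT' cont) auto
    then obtain c where c: "c \<in> {a - 1..a + 1}" "\<Psi> s c = 0" by auto
    have "sol s = c"
    proof (rule sol[OF _ refl xr[OF c(1)]])
      let ?x = "1 - c / sqrt (real s)"
      have "inverse (erlang_B s (real s * ?x)) - sqrt (real s) * Y ?x + F ?x = sqrt (real s) * \<Psi> s c"
        unfolding \<Psi>_def using r by (simp add: algebra_simps)
      then show "inverse (erlang_B s (real s * ?x)) = sqrt (real s) * Y ?x - F ?x"
        using c by simp
    qed (use elim in simp)
    moreover have "\<bar>mills c - mills a + \<delta> * H c\<bar> \<le> C * \<delta>\<^sup>2"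
      using est[OF c(1)] c(2) by simp
    then have "\<bar>c - (a - \<delta> * (H a / (1 + a * mills a)))\<bar> \<le> K * \<delta>\<^sup>2"
      by (intro K(2) \<delta> c)
    ultimately show ?case by (simp add: \<delta>(4)) (simp add: \<delta>_def)
  qed
  then show ?thesis unfolding H_def by (rule bigoI)
qed

section \<open>Identification of the coefficients\<close>

lemma gamma_infF_eq:
  assumes "0 \<le> F q 1" "\<epsilon> > 0" "mills a = (1 + F q 1) / \<epsilon>"
  shows "gamma_infF q \<epsilon> = a"
proof -
  have "(1 + F q 1) * g_inf \<gamma> = \<epsilon> \<longleftrightarrow> mills \<gamma> = mills a" for \<gamma>
    using assms mills_pos[of \<gamma>] by (auto simp: g_inf_eq field_simps)
  then show ?thesis unfolding gamma_infF_def by (simp add: the_mills_eq)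
qed

lemma gamma_infR_eq:
  assumes "\<epsilon> > 0" "mills a = 1 / \<epsilon>"
  shows "gamma_infR \<epsilon> = a"
proof -
  have "g_inf \<gamma> = \<epsilon> \<longleftrightarrow> mills \<gamma> = mills a" for \<gamma>
    unfolding assms(2) g_inf_eq using assms(1) mills_pos[of \<gamma>] by (auto simp: field_simps)
  then show ?thesis unfolding gamma_infR_def by (simp add: the_mills_eq)
qed

text \<open>
  With \<open>m = 1 / g_inf a\<close> one has \<open>g_inf' = - M' / m\<^sup>2\<close>, and \<open>m\<^sup>2 * h_infF\<close> is \<open>- (1 + F(1))\<close> times the
  numerator; the factor \<open>1 / \<epsilon>\<close> enters through \<open>m = (1 + F(1)) / \<epsilon>\<close>.
\<close>

lemma eta_infF_eq:
  assumes F: "0 \<le> F q 1" and "\<epsilon> > 0" and a: "mills a = (1 + F q 1) / \<epsilon>"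
  shows "eta_infF q \<epsilon> = - ((erlang_corr a + F q 1 + deriv (F q) 1 / \<epsilon> * a) / (1 + a * mills a))"
proof -
  define m where "m = mills a"
  define v where "v = 1 + a * m"
  have m: "m > 0" and v: "v > 0"
    using mills_pos[of a] mills_deriv_pos[of a] by (auto simp: m_def v_def)
  have \<epsilon>: "\<epsilon> = (1 + F q 1) / m" using a assms m by (simp add: m_def field_simps)
  have h: "h_infF q a * m\<^sup>2
      = - ((1 + F q 1) * (erlang_corr a + F q 1 + deriv (F q) 1 / \<epsilon> * a))"
    using m F unfolding \<epsilon> h_infF_def h_inf_def erlang_corr_def g_inf_eq m_def[symmetric]
    by (simp add: field_simps power2_eq_square)
  have "eta_infF q \<epsilon> = h_infF q a * m\<^sup>2 / ((1 + F q 1) * v)"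
    unfolding eta_infF_def gamma_infF_eq[OF assms] deriv_g_inf m_def[symmetric] v_def[symmetric]
    using m v F by (simp add: field_simps)
  then show ?thesis
    unfolding h m_def[symmetric] v_def[symmetric] using F by simp
qed

lemma eta_infFR_eq:
  assumes "\<epsilon> > 0" and a: "mills a = 1 / \<epsilon>"
  shows "eta_infFR q \<epsilon> = - ((erlang_corr a + F q 1 + F q 1 / \<epsilon> * a) / (1 + a * mills a))"
proof -
  define m where "m = mills a"
  define v where "v = 1 + a * m"
  have m: "m > 0" and v: "v > 0"
    using mills_pos[of a] mills_deriv_pos[of a] by (auto simp: m_def v_def)
  have \<epsilon>: "\<epsilon> = 1 / m" using a assms m by (simp add: m_def field_simps)
  have h: "h_infFR q a * m\<^sup>2 = - (erlang_corr a + F q 1 + F q 1 / \<epsilon> * a)"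
    using m unfolding \<epsilon> h_infFR_def h_inf_def erlang_corr_def g_inf_eq m_def[symmetric]
    by (simp add: field_simps power2_eq_square)
  have "eta_infFR q \<epsilon> = h_infFR q a * m\<^sup>2 / v"
    unfolding eta_infFR_def gamma_infR_eq[OF assms] deriv_g_inf m_def[symmetric] v_def[symmetric]
    using m v by (simp add: field_simps)
  then show ?thesis
    unfolding h m_def[symmetric] v_def[symmetric] by (simp only: minus_divide_left)
qed

section \<open>The expansion of the thresholds\<close>

theorem theorem7:
  fixes q :: "nat \<Rightarrow> real" and \<epsilon> :: real
  assumes "\<And>n. q n \<in> {0..1}"
    and "P_lim q \<in> {0..<1}"
    and "filterlim (F q) at_top (at_radius q)"
    and "\<epsilon> > 0"
  shows "(\<lambda>s::nat. gamma_sF q s \<epsilon> - (gamma_infF q \<epsilon> + 1 / sqrt (real s) * eta_infF q \<epsilon>))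
           \<in> O(\<lambda>s. 1 / real s)
       \<and> ((\<forall>s\<ge>1. D_FR_monotonic q s) \<longrightarrow>
          (\<lambda>s::nat. gamma_sFR q s \<epsilon> - (gamma_infR \<epsilon> + 1 / sqrt (real s) * eta_infFR q \<epsilon>))
           \<in> O(\<lambda>s. 1 / real s))"
proof -
  note q = assms(1)
  define R where "R = inverse (ereal (P_lim q))"
  have "ereal 1 < R"
    using assms(2) by (cases "P_lim q = 0") (auto simp: R_def field_simps)
  then obtain t where t: "1 < t" "ereal t < R"
    using ereal_dense2[of "ereal 1" R] by auto
  define \<rho> where "\<rho> = min 1 (t - 1)"
  have \<rho>: "\<rho> > 0" "\<rho> \<le> 1" using t by (auto simp: \<rho>_def)
  have near: "0 < x" "ereal x < R" "ereal \<bar>x\<bar> < R" if "\<bar>x - 1\<bar> < \<rho>" for x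
  proof -
    have "0 < x" "x \<le> t" using that by (auto simp: \<rho>_def abs_if split: if_splits)
    then show "0 < x" "ereal x < R" "ereal \<bar>x\<bar> < R" using ereal_less_mono[OF t(2)] by auto
  qed
  define F' where "F' = (\<lambda>x. eval_fps (fps_deriv (policy_fps q)) x :: real)"
  have F: "(F q has_real_derivative F' x) (at x)" if "\<bar>x - 1\<bar> < \<rho>" for x
    unfolding F'_def using near(3)[OF that] by (intro DERIV_F q) (simp add: R_def)
  obtain D where D: "(F' has_real_derivative D) (at 1)"
  proof -
    have "\<exists>D. (F' has_real_derivative D) (at 1)"
      unfolding F'_def using near(3)[of 1] \<rho> by (intro DERIV_deriv_F q) (auto simp: R_def)
    then show ?thesis using that by blast
  qed
  have F1: "F q 1 \<ge> 0" using near(2)[of 1] \<rho> by (intro F_nonneg q) (auto simp: R_def)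
  have pos: "inverse (erlang_B s (real s * x)) + F q x > 0" if "s \<ge> 1" "\<bar>x - 1\<bar> < \<rho>" for s x
    using near[OF that(2)] that
    by (intro add_pos_nonneg F_nonneg q less_le_trans[OF zero_less_one inverse_erlang_B_ge_1])
      (auto simp: R_def)
  have adm: "gamma_P q s < ereal \<gamma>" "\<gamma> < sqrt (real s)"
    if "s \<ge> 1" "\<bar>1 - \<gamma> / sqrt (real s) - 1\<bar> < \<rho>" for s \<gamma>
  proof -
    have "gamma_P q s < ereal \<gamma> \<and> \<gamma> < sqrt (real s)"
      by (subst admissible_iff) (use q that near[OF that(2)] in \<open>auto simp: R_def\<close>)
    then show "gamma_P q s < ereal \<gamma>" "\<gamma> < sqrt (real s)" by auto
  qed
  have part1: "(\<lambda>s::nat. gamma_sF q s \<epsilon> - (gamma_infF q \<epsilon> + 1 / sqrt (real s) * eta_infF q \<epsilon>))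
           \<in> O(\<lambda>s. 1 / real s)"
  proof -
    obtain a where a: "mills a = (1 + F q 1) / \<epsilon>"
      using mills_surj_pos[of "(1 + F q 1) / \<epsilon>"] F1 assms(4) by auto
    have "(\<lambda>s. gamma_sF q s \<epsilon> - (a - 1 / sqrt (real s) *
        ((erlang_corr a + F q 1 + F' 1 / \<epsilon> * a) / (1 + a * mills a)))) \<in> O(\<lambda>s. 1 / real s)"
    proof (rule root_expansion[OF \<rho>, where F' = F' and Y = "\<lambda>x. (1 + F q x) / \<epsilon>" and Y' = "\<lambda>x. F' x / \<epsilon>"])
      show "((\<lambda>x. F' x / \<epsilon>) has_real_derivative D / \<epsilon>) (at 1)"
        by (intro DERIV_cdivide D)
      show "((\<lambda>x. (1 + F q x) / \<epsilon>) has_real_derivative F' x / \<epsilon>) (at x)" if "\<bar>x - 1\<bar> < \<rho>" for x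
        using assms(4) by (auto intro!: derivative_eq_intros F[OF that])
      fix s :: nat and \<gamma> x :: real
      assume s: "1 \<le> s" and x: "x = 1 - \<gamma> / sqrt (real s)" "\<bar>x - 1\<bar> < \<rho>"
        and eq: "inverse (erlang_B s (real s * x)) = sqrt (real s) * ((1 + F q x) / \<epsilon>) - F q x"
      have "sqrt (real s) * D_F q s (real s - \<gamma> * sqrt (real s)) = \<epsilon>"
        unfolding D_F_scaled(1)[OF s x(1) near(1)[OF x(2)]]
        using pos[OF s x(2)] eq assms(4) by (simp add: field_simps)
      then show "gamma_sF q s \<epsilon> = \<gamma>"
        using adm[OF s] x by (intro gamma_sF_eqI q s) auto
    qed (use F a in auto)
    moreover have "F' 1 = deriv (F q) 1" using DERIV_imp_deriv[OF F[of 1]] \<rho> by simp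
    ultimately show ?thesis
      by (simp add: gamma_infF_eq[OF F1 assms(4) a] eta_infF_eq[OF F1 assms(4) a])
  qed
  have part2: "(\<lambda>s::nat. gamma_sFR q s \<epsilon> - (gamma_infR \<epsilon> + 1 / sqrt (real s) * eta_infFR q \<epsilon>))
           \<in> O(\<lambda>s. 1 / real s)" if mono: "\<forall>s\<ge>1. D_FR_monotonic q s"
  proof -
    obtain a where a: "mills a = 1 / \<epsilon>"
      using mills_surj_pos[of "1 / \<epsilon>"] assms(4) by auto
    define Y where "Y = (\<lambda>x. (1 + (1 - 1 / x) * F q x) / \<epsilon>)"
    define Y' where "Y' = (\<lambda>x. (1 / x\<^sup>2 * F q x + (1 - 1 / x) * F' x) / \<epsilon>)"
    have "(\<lambda>s. gamma_sFR q s \<epsilon> - (a - 1 / sqrt (real s) *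
        ((erlang_corr a + F q 1 + Y' 1 * a) / (1 + a * mills a)))) \<in> O(\<lambda>s. 1 / real s)"
    proof (rule root_expansion[OF \<rho>, where F' = F' and Y = Y and Y' = Y'])
      show "(Y' has_real_derivative (- 2 * F q 1 + F' 1 + F' 1) / \<epsilon>) (at 1)"
        unfolding Y'_def using assms(4) \<rho>
        by (auto intro!: derivative_eq_intros F D simp: field_simps)
      show "(Y has_real_derivative Y' x) (at x)" if "\<bar>x - 1\<bar> < \<rho>" for x
        unfolding Y_def Y'_def using assms(4) near(1)[OF that]
        by (auto intro!: derivative_eq_intros F[OF that] simp: field_simps power2_eq_square)
      fix s :: nat and \<gamma> x :: real
      assume s: "1 \<le> s" and x: "x = 1 - \<gamma> / sqrt (real s)" "\<bar>x - 1\<bar> < \<rho>"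
        and eq: "inverse (erlang_B s (real s * x)) = sqrt (real s) * Y x - F q x"
      have "inverse (erlang_B s (real s * x)) + F q x = sqrt (real s) * (1 + (1 - 1 / x) * F q x) / \<epsilon>"
        using eq by (simp add: Y_def)
      then have "sqrt (real s) * D_FR q s (real s - \<gamma> * sqrt (real s)) = \<epsilon>"
        unfolding D_F_scaled(2)[OF s x(1) near(1)[OF x(2)]]
        using pos[OF s x(2)] assms(4) by (simp add: field_simps)
      then show "gamma_sFR q s \<epsilon> = \<gamma>"
        using adm[OF s] x mono s assms(4) by (intro gamma_sFR_eqI q s) auto
    qed (use F a in \<open>auto simp: Y_def\<close>)
    moreover have "Y' 1 = F q 1 / \<epsilon>" by (simp add: Y'_def)
    ultimately show ?thesis
      by (simp add: gamma_infR_eq[OF assms(4) a] eta_infFR_eq[OF assms(4) a])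
  qed
  show ?thesis using part1 part2 by blast
qed

end
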